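(* Let $F_{37}:=(6,\{23,24,25,34,35,45\})$. Then $\lambda_{F_{37}}=80/243$. Furthermore, the $F_{37}$-problem is perfectly $B$-stable with $B:=(2,\{00\})$, and the unique (up to automorphisms of $B$) maximiser of $p(F_{37},B(\boldsymbol x))$ over $\boldsymbol x\in\mathbb S_2$ is $\boldsymbol x=(2/3,1/3)$.
   Context: All graphs are finite and simple. $(m,E)$ denotes the graph or pattern with vertex set $\{0,\dots,m-1\}$ and edge set $E$; $ij$ abbreviates $\{i,j\}$ ($ii$ is a loop). For graphs $F,G$ with $\kappa\le n$ vertices, $p(F,G)$ is the number of $\kappa$-subsets of $V(G)$ inducing a subgraph isomorphic to $F$, divided by $\binom n\kappa$; $p(F,n)$ is the maximum of $p(F,G)$ over $n$-vertex graphs $G$; $\lambda_F=\lim_{n\to\infty}p(F,n)$ (the limit exists). A pattern is a graph in which loops are allowed; its automorphisms are the bijections of the vertex set preserving edges, non-edges, loops and non-loops. For a pattern $B$ on $\{0,\dots,m-1\}$ and disjoint (possibly empty) sets $V_0,\dots,V_{m-1}$, the blowup $B(V_0,\dots,V_{m-1})$ is the simple graph on $\bigcup V_i$ in which distinct $x\in V_i$, $y\in V_j$ are adjacent iff $\{i,j\}\in E(B)$ (so $V_i$ is a clique if $i$ has a loop and independent otherwise); $B()$ is the family of all blowups. $\mathbb S_m=\{\boldsymbol x\in\mathbb R^m:x_i\ge0,\sum x_i=1\}$, and $p(F,B(\boldsymbol x))$ is the limit as $n\to\infty$ of $p(F,B(V_0,\dots,V_{m-1}))$ with $|V_i|=(x_i+o(1))n$.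 $\delta_{\mathrm{edit}}(G,B())$ is the minimum number of vertex pairs whose adjacency must be changed to turn $G$ into a graph isomorphic to a blowup of $B$ (of the same order). The $F$-problem is perfectly $B$-stable if there is $C>0$ such that every graph $G$ with $n\ge C$ vertices satisfies $\delta_{\mathrm{edit}}(G,B())\le C\,(p(F,n)-p(F,G))\,n^2$. *)

theory Defs
  imports Complex_Main "HOL-Library.Disjoint_Sets"
begin

text \<open>
  A graph or pattern is a pair of a vertex set and an edge set, where the edge between \<open>i\<close> and \<open>j\<close>
  is the set \<open>{i, j}\<close>; thus a loop at \<open>i\<close> is the singleton \<open>{i}\<close>.
\<close>

type_synonym 'a pattern = "'a set \<times> 'a set set"

abbreviation verts :: "'a pattern \<Rightarrow> 'a set" where "verts \<equiv> fst"
abbreviation edges :: "'a pattern \<Rightarrow> 'a set set" where "edges \<equiv> snd"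

definition simple_graph :: "'a pattern \<Rightarrow> bool" where
  "simple_graph G \<longleftrightarrow> finite (verts G) \<and> edges G \<subseteq> {e. e \<subseteq> verts G \<and> card e = 2}"

text \<open>The case \<open>x = y\<close> below says that loops and non-loops are preserved.\<close>

definition isomorphism :: "('a \<Rightarrow> 'b) \<Rightarrow> 'a pattern \<Rightarrow> 'b pattern \<Rightarrow> bool" where
  "isomorphism f P Q \<longleftrightarrow> bij_betw f (verts P) (verts Q) \<and>
     (\<forall>x\<in>verts P. \<forall>y\<in>verts P. {x, y} \<in> edges P \<longleftrightarrow> {f x, f y} \<in> edges Q)"

definition isomorphic :: "'a pattern \<Rightarrow> 'b pattern \<Rightarrow> bool" where
  "isomorphic P Q \<longleftrightarrow> (\<exists>f. isomorphism f P Q)"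

definition automorphism :: "('a \<Rightarrow> 'a) \<Rightarrow> 'a pattern \<Rightarrow> bool" where
  "automorphism f P \<longleftrightarrow> isomorphism f P P"

definition induced :: "'a pattern \<Rightarrow> 'a set \<Rightarrow> 'a pattern" where
  "induced G S = (S, {e \<in> edges G. e \<subseteq> S})"

definition induced_density :: "'a pattern \<Rightarrow> 'b pattern \<Rightarrow> real" where
  "induced_density F G =
     real (card {S. S \<subseteq> verts G \<and> card S = card (verts F) \<and> isomorphic F (induced G S)})
     / real (card (verts G) choose card (verts F))"

text \<open>
  Graphs with vertices in \<open>nat\<close> represent all finite graphs up to isomorphism.  The set of
  densities is finite and nonempty, so \<open>Max\<close> is a genuine maximum.
\<close>

definition max_density :: "'a pattern \<Rightarrow> nat \<Rightarrow> real" where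
  "max_density F n =
     Max {induced_density F G | G :: nat pattern. simple_graph G \<and> card (verts G) = n}"

definition inducibility :: "'a pattern \<Rightarrow> real" where
  "inducibility F = lim (max_density F)"

definition blowup :: "'i pattern \<Rightarrow> ('i \<Rightarrow> 'a set) \<Rightarrow> 'a pattern" where
  "blowup B V = (\<Union>i\<in>verts B. V i,
     {{x, y} | x y. x \<noteq> y \<and>
        (\<exists>i\<in>verts B. \<exists>j\<in>verts B. x \<in> V i \<and> y \<in> V j \<and> {i, j} \<in> edges B)})"

definition blowup_parts :: "'i pattern \<Rightarrow> ('i \<Rightarrow> 'a set) \<Rightarrow> bool" where
  "blowup_parts B V \<longleftrightarrow> disjoint_family_on V (verts B) \<and> (\<forall>i\<in>verts B. finite (V i))"

definition blowups :: "'i pattern \<Rightarrow> 'a pattern set" where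
  "blowups B = {blowup B V | V. blowup_parts B V}"

text \<open>
  Changing adjacencies in \<open>G\<close> yields a graph \<open>H\<close> on the same vertices; the changed pairs form the
  symmetric difference of the edge sets.
\<close>

definition edit_distance :: "'a pattern \<Rightarrow> 'i pattern \<Rightarrow> nat" where
  "edit_distance G B = (LEAST k. \<exists>H. simple_graph H \<and> verts H = verts G \<and>
     (\<exists>H' \<in> (blowups B :: 'a pattern set). isomorphic H H') \<and>
     k = card ((edges G - edges H) \<union> (edges H - edges G)))"

definition perfectly_stable :: "'a pattern \<Rightarrow> 'i pattern \<Rightarrow> bool" where
  "perfectly_stable F B \<longleftrightarrow> (\<exists>C > 0 :: real. \<forall>G :: nat pattern.
     simple_graph G \<longrightarrow> C \<le> real (card (verts G)) \<longrightarrow>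
     real (edit_distance G B) \<le>
       C * (max_density F (card (verts G)) - induced_density F G) * real (card (verts G)) ^ 2)"

text \<open>
  Points of \<open>\<real>\<^sup>m\<close> are lists of length \<open>m\<close>, and patterns whose blowups are weighted by such points
  have vertex set \<open>{0..<m}\<close>.
\<close>

definition std_simplex :: "nat \<Rightarrow> real list set" where
  "std_simplex m = {x. length x = m \<and> (\<forall>i<m. 0 \<le> x ! i) \<and> (\<Sum>i<m. x ! i) = 1}"

text \<open>
  The common limit of \<open>induced_density F (blowup B (V n))\<close> along all sequences of parts
  with \<open>\<bar>V n i\<bar> = (x\<^sub>i + o(1)) n\<close>.
\<close>

definition blowup_density :: "'a pattern \<Rightarrow> nat pattern \<Rightarrow> real list \<Rightarrow> real" where
  "blowup_density F B x = (THE l. \<forall>V :: nat \<Rightarrow> nat \<Rightarrow> nat set.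
     (\<forall>n. blowup_parts B (V n)) \<and>
     (\<forall>i\<in>verts B. (\<lambda>n. real (card (V n i)) / real n) \<longlonglongrightarrow> x ! i) \<longrightarrow>
     (\<lambda>n. induced_density F (blowup B (V n))) \<longlonglongrightarrow> l)"

definition maximiser :: "'a pattern \<Rightarrow> nat pattern \<Rightarrow> real list \<Rightarrow> bool" where
  "maximiser F B = is_arg_max (blowup_density F B) (\<lambda>x. x \<in> std_simplex (card (verts B)))"

definition unique_maximiser_up_to_aut :: "'a pattern \<Rightarrow> nat pattern \<Rightarrow> real list \<Rightarrow> bool" where
  "unique_maximiser_up_to_aut F B x \<longleftrightarrow> maximiser F B x \<and>
     (\<forall>y. maximiser F B y \<longrightarrow>
        (\<exists>s. automorphism s B \<and> y = map (\<lambda>i. x ! s i) [0..<length x]))"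

definition F37 :: "nat pattern" where
  "F37 = ({0..<6}, {{2,3}, {2,4}, {2,5}, {3,4}, {3,5}, {4,5}})"

definition B37 :: "nat pattern" where
  "B37 = ({0..<2}, {{0,0}})"

end

theory Submission
  imports Defs
begin

text \<open>
  A copy of the graph \<open>F37\<close> is a set of six vertices on which the edges form exactly a clique on four
  of them.  Why are a clique and isolated vertices, in proportion \<open>2 : 1\<close>, essentially optimal?

  \<^emph>\<open>Symmetrisation.\<close>  Let \<open>u\<close> and \<open>v\<close> be adjacent.  Replacing \<open>u\<close> by an adjacent twin of \<open>v\<close>, or \<open>v\<close> by
  one of \<open>u\<close>, does not decrease the number of copies on average, because a copy that contains both of
  them has both in its clique and therefore survives (\<open>card_copies_clone\<close>).  Breaking ties by the
  number of pairs of twins, one reaches from every graph a graph in which adjacent vertices are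
  twins, that is, a disjoint union of cliques.  This is phrased as the induction principle
  \<open>symmetrisation_induct\<close>; each of its steps changes at most \<open>n\<close> pairs of an \<open>n\<close>-vertex graph.

  \<^emph>\<open>Unions of cliques.\<close>  For cliques of relative sizes \<open>x\<^sub>i\<close> the number of copies is at most \<open>n^6 / 48\<close> times
  the sum of \<open>x\<^sub>i^4 ((1 - x\<^sub>i)^2 - (\<Sum>j\<noteq>i. x\<^sub>j^2))\<close>.  If the largest size \<open>a\<close> is below \<open>1/2\<close>, this sum stays away
  from \<open>16/729\<close>; otherwise it is at most \<open>a^4 (1 - a)^2 \<le> 16/729\<close> minus a multiple of the squares of
  the other sizes (\<open>cliques_sum_le\<close>).  So every graph has at most \<open>n^6 / 2187\<close> copies
  (\<open>card_copies_le\<close>), and a union of cliques that nearly attains this has few edges outside its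
  largest clique.

  \<^emph>\<open>Near the extremal graphs.\<close>  Let the pairs in which a graph differs from a closest clique with
  isolated vertices be called wrong, and let there be few of them.  If a vertex \<open>v\<close> is in many wrong
  pairs, then by minimality it fits neither side, and as the count at \<open>v\<close> is strictly convex in the
  number of its neighbours, correcting \<open>v\<close> gains of order \<open>n^5\<close> copies (\<open>correct_vertex_gain\<close>).  If there is no
  such vertex, then correcting any single wrong pair gains of order \<open>n^4\<close> copies
  (\<open>correct_pair_gain\<close>).  Repeating this bounds the number of wrong pairs linearly by the missing
  number of copies (\<open>local_stability\<close>).

  \<^emph>\<open>From local to global.\<close>  Suppose that a graph has nearly \<open>n^6 / 2187\<close> copies.  All graphs on its
  symmetrisation path have at least as many, the path ends close to a clique with isolated
  vertices, and it moves in steps of \<open>n\<close> pairs.  A graph at moderate distance would be in the range of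
  \<open>local_stability\<close> and so would in fact be much closer; hence the path never leaves the close range
  (\<open>global_stability\<close>).  Perfect stability follows; the limit and the maximiser are then a
  computation with \<open>15 x^4 (1 - x)^2\<close>.

  The constants serve the following purposes for \<open>n \<ge> 10^23\<close>.  A vertex is bad if it is in more than
  \<open>n / 10^4\<close> wrong pairs.  The clique has size within \<open>n / 10^6\<close> of \<open>2 n / 3\<close>, a hundredth of that, so
  that this error does not outweigh the gain at a bad vertex.  The local argument works up to
  distance \<open>n^2 / (2 * 10^15)\<close>, which forces that size if there are nearly \<open>n^6 / 2187\<close> copies.  A wrong pair costs at least
  \<open>5 n^4 / 10^8\<close> copies, and graphs within \<open>n^6 / 10^23\<close> copies of the bound are close to extremal.
\<close>


section \<open>Copies as a clique on four of six vertices\<close>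

definition pairs :: "'a set \<Rightarrow> 'a set set" where
  "pairs A = {e. e \<subseteq> A \<and> card e = 2}"

definition copy :: "'a set set \<Rightarrow> 'a set \<Rightarrow> bool" where
  "copy E S \<longleftrightarrow> (\<exists>Q\<subseteq>S. card S = 6 \<and> card Q = 4 \<and> E \<inter> pairs S = pairs Q)"

definition copies :: "'a set \<Rightarrow> 'a set set \<Rightarrow> 'a set set" where
  "copies V E = {S. S \<subseteq> V \<and> copy E S}"

lemma pairs_insert_iff [simp]: "{x, y} \<in> pairs A \<longleftrightarrow> x \<in> A \<and> y \<in> A \<and> x \<noteq> y"
  by (auto simp: pairs_def card_insert_if)

lemma singleton_notin_pairs [simp]: "{x} \<notin> pairs A"
  by (simp add: pairs_def)

lemma pairsE:
  assumes "e \<in> pairs A"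
  obtains x y where "e = {x, y}" "x \<noteq> y" "x \<in> A" "y \<in> A"
  using assms by (auto simp: pairs_def card_2_iff)

lemma pairs_mono: "A \<subseteq> B \<Longrightarrow> pairs A \<subseteq> pairs B"
  by (auto simp: pairs_def)

lemma pairs_Int: "pairs A \<inter> pairs B = pairs (A \<inter> B)"
  by (auto simp: pairs_def)

lemma finite_pairs [simp]: "finite A \<Longrightarrow> finite (pairs A)"
  by (simp add: pairs_def)

lemma card_pairs: "finite A \<Longrightarrow> card (pairs A) = card A choose 2"
  by (simp add: pairs_def n_subsets)

lemma pairs_eqI:
  assumes "E \<subseteq> pairs V" "F \<subseteq> pairs W"
    and "\<And>x y. x \<noteq> y \<Longrightarrow> {x, y} \<in> E \<longleftrightarrow> {x, y} \<in> F"
  shows "E = F"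
proof (intro equalityI subsetI)
  fix e assume "e \<in> E"
  then show "e \<in> F" using assms by (metis pairsE subsetD)
next
  fix e assume "e \<in> F"
  then show "e \<in> E" using assms by (metis pairsE subsetD)
qed

lemma pairs_inject:
  assumes "pairs Q = pairs R" "card Q \<ge> 2"
  shows "Q = R"
proof -
  have fin: "finite Q" using assms(2) by (metis card.infinite not_numeral_le_zero)
  have other: "\<exists>y\<in>Q. y \<noteq> x" for x
  proof (rule ccontr)
    assume "\<not> ?thesis"
    then have "Q \<subseteq> {x}" by auto
    then have "card Q \<le> 1" by (metis card_mono card.empty card_insert_disjoint empty_iff
          finite.emptyI finite_insert One_nat_def)
    then show False using assms(2) by simp
  qed
  have sub: "Q \<subseteq> R"
  proof
    fix x assume "x \<in> Q"
    moreover obtain y where "y \<in> Q" "y \<noteq> x" using other by blast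
    ultimately have "{x, y} \<in> pairs Q" by simp
    then show "x \<in> R" unfolding assms(1) by simp
  qed
  have "R \<subseteq> Q"
  proof
    fix x assume "x \<in> R"
    moreover obtain y where "y \<in> Q" "y \<noteq> x" using other by blast
    ultimately have "{x, y} \<in> pairs R" using sub by auto
    then show "x \<in> Q" unfolding assms(1)[symmetric] by simp
  qed
  with sub show ?thesis by blast
qed

lemma copy_iff:
  "copy E S \<longleftrightarrow> (\<exists>Q\<subseteq>S. card S = 6 \<and> card Q = 4 \<and>
     (\<forall>x\<in>S. \<forall>y\<in>S. x \<noteq> y \<longrightarrow> ({x, y} \<in> E \<longleftrightarrow> x \<in> Q \<and> y \<in> Q)))"
proof -
  have "E \<inter> pairs S = pairs Q \<longleftrightarrow>
      (\<forall>x\<in>S. \<forall>y\<in>S. x \<noteq> y \<longrightarrow> ({x, y} \<in> E \<longleftrightarrow> x \<in> Q \<and> y \<in> Q))" if "Q \<subseteq> S" for Q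
  proof
    assume eq: "E \<inter> pairs S = pairs Q"
    have "{x, y} \<in> E \<inter> pairs S \<longleftrightarrow> {x, y} \<in> pairs Q" for x y using eq by simp
    then show "\<forall>x\<in>S. \<forall>y\<in>S. x \<noteq> y \<longrightarrow> ({x, y} \<in> E \<longleftrightarrow> x \<in> Q \<and> y \<in> Q)" by auto
  next
    assume R: "\<forall>x\<in>S. \<forall>y\<in>S. x \<noteq> y \<longrightarrow> ({x, y} \<in> E \<longleftrightarrow> x \<in> Q \<and> y \<in> Q)"
    show "E \<inter> pairs S = pairs Q"
      by (rule pairs_eqI[of _ S _ Q]) (use R that in auto)
  qed
  then show ?thesis unfolding copy_def by blast
qed

lemma copy_cong: "E \<inter> pairs S = E' \<inter> pairs S \<Longrightarrow> copy E S \<longleftrightarrow> copy E' S"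
  by (simp add: copy_def)

lemma copy_image:
  assumes "copy E S" "inj_on f S"
    and "\<And>x y. x \<in> S \<Longrightarrow> y \<in> S \<Longrightarrow> x \<noteq> y \<Longrightarrow> {x, y} \<in> E \<longleftrightarrow> {f x, f y} \<in> E'"
  shows "copy E' (f ` S)"
proof -
  obtain Q where Q: "Q \<subseteq> S" "card S = 6" "card Q = 4"
    and R: "\<And>x y. x \<in> S \<Longrightarrow> y \<in> S \<Longrightarrow> x \<noteq> y \<Longrightarrow> {x, y} \<in> E \<longleftrightarrow> x \<in> Q \<and> y \<in> Q"
    using assms(1) unfolding copy_iff by blast
  have "card (f ` S) = 6" "card (f ` Q) = 4"
    using Q assms(2) by (auto simp: card_image inj_on_subset)
  moreover have "f x \<in> f ` Q \<longleftrightarrow> x \<in> Q" if "x \<in> S" for x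
    using that Q(1) assms(2) by (meson inj_on_image_mem_iff)
  moreover have "{f x, f y} \<in> E' \<longleftrightarrow> f x \<in> f ` Q \<and> f y \<in> f ` Q"
    if "x \<in> S" "y \<in> S" "f x \<noteq> f y" for x y
  proof -
    have "x \<noteq> y" using that(3) by auto
    then show ?thesis using that calculation(3) R assms(3) by auto
  qed
  ultimately show ?thesis
    unfolding copy_iff using Q(1) by (intro exI[of _ "f ` Q"]) auto
qed

lemma edges_F37: "edges F37 = pairs {2, 3, 4, 5}"
proof (rule pairs_eqI[of _ UNIV _ "{2,3,4,5}"])
  show "edges F37 \<subseteq> pairs UNIV" by (auto simp: F37_def pairs_def)
  fix x y :: nat assume "x \<noteq> y"
  then show "{x, y} \<in> edges F37 \<longleftrightarrow> {x, y} \<in> pairs {2, 3, 4, 5}"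
    by (auto simp: F37_def doubleton_eq_iff)
qed auto

lemma isomorphic_F37_iff:
  assumes "edges G \<subseteq> pairs (verts G)"
  shows "isomorphic F37 (induced G S) \<longleftrightarrow> copy (edges G) S"
proof
  assume "isomorphic F37 (induced G S)"
  then obtain f where f: "bij_betw f {0..<6} S"
    and R: "\<And>x y. x < 6 \<Longrightarrow> y < 6 \<Longrightarrow>
      {x, y} \<in> edges F37 \<longleftrightarrow> {f x, f y} \<in> edges (induced G S)"
    by (auto simp: isomorphic_def isomorphism_def induced_def F37_def)
  have "copy (edges F37) {0..<6}"
    unfolding copy_def edges_F37 pairs_Int
    by (intro exI[of _ "{2, 3, 4, 5}"]) (auto intro!: arg_cong[of _ _ pairs])
  then have "copy (edges (induced G S)) (f ` {0..<6})"
    by (rule copy_image) (use f R in \<open>auto simp: bij_betw_def\<close>)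
  then have "copy (edges (induced G S)) S" using f by (simp add: bij_betw_def)
  then show "copy (edges G) S"
    by (subst copy_cong[of _ _ "edges (induced G S)"]) (auto simp: induced_def pairs_def)
next
  assume "copy (edges G) S"
  then obtain Q where Q: "Q \<subseteq> S" "card S = 6" "card Q = 4" "edges G \<inter> pairs S = pairs Q"
    unfolding copy_def by blast
  have fin: "finite S" "finite Q"
    using Q by (metis card.infinite zero_neq_numeral)+
  have "card (S - Q) = 2" using Q fin by (simp add: card_Diff_subset)
  then obtain g where g: "bij_betw g {0, 1::nat} (S - Q)"
    by (metis card_2_iff fin(1) finite_Diff finite_same_card_bij finite.emptyI finite_insert zero_neq_one)
  have "card {2, 3, 4, 5::nat} = card Q" using Q by simp
  then obtain h where h: "bij_betw h {2, 3, 4, 5::nat} Q"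
    by (metis fin(2) finite_same_card_bij finite.emptyI finite_insert)
  define f where "f = (\<lambda>x. if x \<in> {0, 1} then g x else h x)"
  have f1: "bij_betw f {0, 1} (S - Q)"
    using g by (rule bij_betw_cong[THEN iffD1, rotated]) (simp add: f_def)
  have f2: "bij_betw f {2, 3, 4, 5} Q"
    using h by (rule bij_betw_cong[THEN iffD1, rotated]) (auto simp: f_def)
  have "bij_betw f ({0, 1} \<union> {2, 3, 4, 5}) ((S - Q) \<union> Q)"
    using f1 f2 by (rule bij_betw_combine) auto
  moreover have "{0, 1} \<union> {2, 3, 4, 5} = {0..<6::nat}" by auto
  moreover have "(S - Q) \<union> Q = S" using Q by auto
  ultimately have f: "bij_betw f {0..<6} S" by simp
  have inQ: "f x \<in> Q \<longleftrightarrow> x \<in> {2, 3, 4, 5}" if "x < 6" for x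
  proof -
    have "x \<in> {0, 1} \<union> {2, 3, 4, 5}" using that by auto
    then show ?thesis using f1 f2 unfolding bij_betw_def by fastforce
  qed
  have E: "edges (induced G S) = pairs Q"
    using Q assms by (auto simp: induced_def pairs_def)
  have "{x, y} \<in> edges F37 \<longleftrightarrow> {f x, f y} \<in> edges (induced G S)" if "x < 6" "y < 6" for x y
  proof -
    have "f x = f y \<longleftrightarrow> x = y"
      using f that by (auto simp: bij_betw_def inj_on_def)
    then show ?thesis
      unfolding edges_F37 E pairs_insert_iff using inQ that by auto
  qed
  then have "isomorphism f F37 (induced G S)"
    using f by (auto simp: isomorphism_def F37_def induced_def)
  then show "isomorphic F37 (induced G S)" unfolding isomorphic_def by blast
qed

lemma induced_density_F37:
  assumes "edges G \<subseteq> pairs (verts G)"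
  shows "induced_density F37 G =
    real (card (copies (verts G) (edges G))) / real (card (verts G) choose 6)"
proof -
  have "copy E S \<Longrightarrow> card S = 6" for E and S :: "'a set" by (auto simp: copy_def)
  moreover have "card (verts F37) = 6" by (simp add: F37_def)
  ultimately have "{S. S \<subseteq> verts G \<and> card S = card (verts F37) \<and> isomorphic F37 (induced G S)}
      = copies (verts G) (edges G)"
    by (auto simp: copies_def isomorphic_F37_iff[OF assms])
  then show ?thesis unfolding induced_density_def by (simp add: F37_def)
qed

section \<open>Symmetrisation\<close>

lemma finite_copies [simp]: "finite V \<Longrightarrow> finite (copies V E)"
  by (simp add: copies_def)

definition closed_nbhd :: "'a set set \<Rightarrow> 'a \<Rightarrow> 'a set" where
  "closed_nbhd E x = insert x {y. {x, y} \<in> E}"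

definition clone :: "'a set set \<Rightarrow> 'a \<Rightarrow> 'a \<Rightarrow> 'a set set" where
  "clone E u v = {e \<in> E. u \<notin> e} \<union> {{u, x} | x. x \<noteq> u \<and> x \<in> closed_nbhd E v}"

lemma clone_iff:
  "x \<noteq> y \<Longrightarrow> {x, y} \<in> clone E u v \<longleftrightarrow>
    (if x = u then y \<in> closed_nbhd E v else if y = u then x \<in> closed_nbhd E v else {x, y} \<in> E)"
  by (auto simp: clone_def doubleton_eq_iff)

lemma closed_nbhd_subset: "E \<subseteq> pairs V \<Longrightarrow> x \<in> V \<Longrightarrow> closed_nbhd E x \<subseteq> V"
  by (auto simp: closed_nbhd_def pairs_def)

lemma clone_subset:
  assumes "E \<subseteq> pairs V" "{u, v} \<in> E"
  shows "clone E u v \<subseteq> pairs V"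
proof -
  have "u \<in> V" "v \<in> V" using assms by auto
  then show ?thesis
    using assms closed_nbhd_subset[OF assms(1), of v] by (auto simp: clone_def)
qed

lemma card_edges_at:
  assumes "W \<subseteq> pairs V"
  shows "card {f \<in> W. v \<in> f} = card {x. {v, x} \<in> W}"
proof -
  have "{f \<in> W. v \<in> f} = (\<lambda>x. {v, x}) ` {x. {v, x} \<in> W}"
  proof (intro equalityI subsetI)
    fix f assume f: "f \<in> {f \<in> W. v \<in> f}"
    then have "f \<in> pairs V" using assms by blast
    then obtain x y where "f = {x, y}" by (rule pairsE)
    with f show "f \<in> (\<lambda>x. {v, x}) ` {x. {v, x} \<in> W}" by (auto simp: insert_commute)
  qed auto
  moreover have "inj_on (\<lambda>x. {v, x}) {x. {v, x} \<in> W}"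
    by (auto simp: inj_on_def doubleton_eq_iff)
  ultimately show ?thesis by (simp add: card_image)
qed

lemma card_edges_at_le:
  assumes "W \<subseteq> pairs V" "finite V"
  shows "card {f \<in> W. v \<in> f} \<le> card V"
proof -
  have "{x. {v, x} \<in> W} \<subseteq> V" using assms(1) by auto
  then show ?thesis unfolding card_edges_at[OF assms(1)] by (rule card_mono[OF assms(2)])
qed

lemma card_sym_diff_clone:
  assumes "finite V" "E \<subseteq> pairs V" "{u, v} \<in> E"
  shows "card (sym_diff E (clone E u v)) \<le> card V"
proof -
  have sub: "sym_diff E (clone E u v) \<subseteq> pairs V"
    using assms(2) clone_subset[OF assms(2,3)] by blast
  have "sym_diff E (clone E u v) = {f \<in> sym_diff E (clone E u v). u \<in> f}"
    by (auto simp: clone_def)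
  then show ?thesis using card_edges_at_le[OF sub assms(1), of u] by simp
qed

lemma card_split:
  assumes "finite X"
  shows "card X = card {S \<in> X. u \<notin> S} + card {S \<in> X. u \<in> S}"
proof -
  have "X = {S \<in> X. u \<notin> S} \<union> {S \<in> X. u \<in> S}" by auto
  then show ?thesis using assms by (metis (no_types, lifting) card_Un_disjoint
        disjoint_iff finite_Un mem_Collect_eq)
qed

lemma clone_copy_without:
  assumes "u \<notin> S"
  shows "copy (clone E u v) S \<longleftrightarrow> copy E S"
proof (rule copy_cong)
  show "clone E u v \<inter> pairs S = E \<inter> pairs S"
    by (rule pairs_eqI[of _ S _ S]) (use assms in \<open>auto simp: clone_iff\<close>)
qed

lemma clone_copy_both:
  assumes "u \<in> S" "v \<in> S" "{u, v} \<in> E" "u \<noteq> v" "copy E S"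
  shows "copy (clone E u v) S"
proof -
  obtain Q where Q: "Q \<subseteq> S" "card S = 6" "card Q = 4"
    and R: "\<And>x y. x \<in> S \<Longrightarrow> y \<in> S \<Longrightarrow> x \<noteq> y \<Longrightarrow> {x, y} \<in> E \<longleftrightarrow> x \<in> Q \<and> y \<in> Q"
    using assms(5) unfolding copy_iff by blast
  have uv: "u \<in> Q" "v \<in> Q" using R[of u v] assms by auto
  have nb: "x \<in> closed_nbhd E v \<longleftrightarrow> x \<in> Q" if "x \<in> S" for x
    using that R[of v x] uv assms(2) by (auto simp: closed_nbhd_def)
  have "{x, y} \<in> clone E u v \<longleftrightarrow> x \<in> Q \<and> y \<in> Q" if "x \<in> S" "y \<in> S" "x \<noteq> y" for x y
    using that R[of x y] nb uv by (auto simp: clone_iff)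
  then show ?thesis unfolding copy_iff using Q by blast
qed

text \<open>
  Compare copies by which of \<open>u\<close> and \<open>v\<close> they contain.  Making \<open>u\<close> a twin of \<open>v\<close> trades the copies that
  contain only \<open>u\<close> for as many as contain only \<open>v\<close>, and preserves those that contain both or none; the
  opposite operation makes the opposite trade.
\<close>

lemma card_copies_clone:
  assumes "finite V" "E \<subseteq> pairs V" "{u, v} \<in> E"
  shows "2 * card (copies V E) \<le>
    card (copies V (clone E u v)) + card (copies V (clone E v u))"
proof -
  have "{u, v} \<in> pairs V" using assms(2,3) by blast
  then have uv: "u \<in> V" "v \<in> V" "u \<noteq> v" by simp_all
  define none where "none = card {S \<in> copies V E. u \<notin> S \<and> v \<notin> S}"
  define both where "both = card {S \<in> copies V E. u \<in> S \<and> v \<in> S}"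
  define only where "only x y = card {S \<in> copies V E. x \<in> S \<and> y \<notin> S}" for x y
  have expand: "card (copies V E') =
      card {S \<in> copies V E'. x \<notin> S \<and> y \<notin> S} + card {S \<in> copies V E'. y \<in> S \<and> x \<notin> S}
      + card {S \<in> copies V E'. x \<in> S \<and> y \<notin> S} + card {S \<in> copies V E'. x \<in> S \<and> y \<in> S}"
    for E' x y
    using assms(1) card_split[of "copies V E'" x] card_split[of "{S \<in> copies V E'. x \<in> S}" y]
      card_split[of "{S \<in> copies V E'. x \<notin> S}" y] by (simp add: conj_ac)
  have gain: "card {S \<in> copies V E. x \<notin> S \<and> y \<notin> S} + 2 * only y x
      + card {S \<in> copies V E. x \<in> S \<and> y \<in> S} \<le> card (copies V (clone E x y))"
    if xy: "{x, y} \<in> E" "x \<in> V" "y \<in> V" "x \<noteq> y" for x y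
  proof -
    let ?E = "clone E x y"
    have 1: "{S \<in> copies V ?E. x \<notin> S \<and> y \<notin> S} = {S \<in> copies V E. x \<notin> S \<and> y \<notin> S}"
      "{S \<in> copies V ?E. y \<in> S \<and> x \<notin> S} = {S \<in> copies V E. y \<in> S \<and> x \<notin> S}"
      by (auto simp: copies_def clone_copy_without)
    have 2: "card {S \<in> copies V E. x \<in> S \<and> y \<in> S} \<le> card {S \<in> copies V ?E. x \<in> S \<and> y \<in> S}"
      by (rule card_mono) (use assms xy clone_copy_both in \<open>auto simp: copies_def\<close>)
    have 3: "only y x \<le> card {S \<in> copies V ?E. x \<in> S \<and> y \<notin> S}"
      unfolding only_def
    proof (rule card_inj_on_le)
      let ?f = "\<lambda>z. if z = y then x else z"
      show "inj_on ((`) ?f) {S \<in> copies V E. y \<in> S \<and> x \<notin> S}"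
      proof (rule inj_onI)
        fix S T assume S: "S \<in> {S \<in> copies V E. y \<in> S \<and> x \<notin> S}"
          and T: "T \<in> {S \<in> copies V E. y \<in> S \<and> x \<notin> S}" and eq: "?f ` S = ?f ` T"
        have "?f ` U = insert x (U - {y})" if "y \<in> U" for U using that by auto
        then have "insert x (S - {y}) = insert x (T - {y})" using S T eq by auto
        then have "insert y (insert x (S - {y}) - {x}) = insert y (insert x (T - {y}) - {x})"
          by simp
        moreover have "insert y (insert x (U - {y}) - {x}) = U" if "y \<in> U" "x \<notin> U" for U
          using that by auto
        ultimately show "S = T" using S T by auto
      qed
      show "(`) ?f ` {S \<in> copies V E. y \<in> S \<and> x \<notin> S} \<subseteq> {S \<in> copies V ?E. x \<in> S \<and> y \<notin> S}"
      proof clarify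
        fix S assume S: "S \<in> copies V E" "y \<in> S" "x \<notin> S"
        have "?f ` S \<in> copies V ?E"
        proof -
          have "copy ?E (?f ` S)"
          proof (rule copy_image)
            show "copy E S" using S by (simp add: copies_def)
            show "inj_on ?f S" using S by (auto simp: inj_on_def)
            fix a b assume ab: "a \<in> S" "b \<in> S" "a \<noteq> b"
            have nb: "c \<in> closed_nbhd E y \<longleftrightarrow> {y, c} \<in> E" if "c \<noteq> y" for c
              using that by (simp add: closed_nbhd_def)
            have "a \<noteq> x" "b \<noteq> x" using ab S by auto
            then show "{a, b} \<in> E \<longleftrightarrow> {?f a, ?f b} \<in> ?E"
              using ab(3) nb[of a] nb[of b]
              by (cases "a = y"; cases "b = y") (simp_all add: clone_iff insert_commute[of a])
          qed
          moreover have "?f ` S \<subseteq> V" using S xy by (auto simp: copies_def)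
          ultimately show ?thesis by (simp add: copies_def)
        qed
        moreover have "x \<in> ?f ` S" using S by auto
        moreover have "y \<notin> ?f ` S" using xy(4) by (auto split: if_splits)
        ultimately show "?f ` S \<in> copies V ?E \<and> x \<in> ?f ` S \<and> y \<notin> ?f ` S" by blast
      qed
      show "finite {S \<in> copies V ?E. x \<in> S \<and> y \<notin> S}" using assms by simp
    qed
    show ?thesis using 1 2 3 expand[of ?E x y] unfolding only_def by simp
  qed
  have "none + 2 * only v u + both \<le> card (copies V (clone E u v))"
    using gain[of u v] uv assms(3) unfolding none_def both_def by simp
  moreover have "none + 2 * only u v + both \<le> card (copies V (clone E v u))"
    using gain[of v u] uv assms(3) unfolding none_def both_def
    by (simp add: insert_commute conj_ac)
  moreover have "card (copies V E) = none + only v u + only u v + both"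
    using expand[of E u v] unfolding none_def both_def only_def by simp
  ultimately show ?thesis by simp
qed

definition twins :: "'a set \<Rightarrow> 'a set set \<Rightarrow> ('a \<times> 'a) set" where
  "twins V E = {(x, y) \<in> V \<times> V. closed_nbhd E x = closed_nbhd E y}"

text \<open>
  Among two adjacent vertices that are not twins, the one with the smaller twin class is moved to
  the larger class.  Its class loses one member, the larger one gains one, and no other pair of
  twins is separated.
\<close>

lemma card_twins_clone:
  assumes "finite V" "E \<subseteq> pairs V" "{u, v} \<in> E" "closed_nbhd E u \<noteq> closed_nbhd E v"
    and "card {y \<in> V. closed_nbhd E y = closed_nbhd E u} \<le>
      card {y \<in> V. closed_nbhd E y = closed_nbhd E v}"
  shows "card (twins V E) < card (twins V (clone E u v))"
proof -
  let ?U = "{y \<in> V. closed_nbhd E y = closed_nbhd E u}"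
  let ?W = "{y \<in> V. closed_nbhd E y = closed_nbhd E v}"
  let ?E = "clone E u v"
  let ?T = "{(x, y) \<in> twins V E. x \<noteq> u \<and> y \<noteq> u}"
  have uv: "u \<in> V" "v \<in> V" "u \<noteq> v" using assms by auto
  have fin: "finite (twins V E)" "finite (twins V ?E)"
    using assms(1) by (auto simp: twins_def intro: finite_subset[of _ "V \<times> V"])
  have uW: "u \<notin> ?W" using assms(4) by simp
  have nu: "closed_nbhd ?E u = closed_nbhd E v"
    using assms(3) uv
    by (auto simp: closed_nbhd_def clone_def doubleton_eq_iff insert_commute[of u v])
  have nx: "closed_nbhd ?E x =
      (if v \<in> closed_nbhd E x then insert u (closed_nbhd E x) else closed_nbhd E x - {u})"
    if "x \<noteq> u" for x
  proof -
    have "v \<in> closed_nbhd E x \<longleftrightarrow> x \<in> closed_nbhd E v"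
      by (auto simp: closed_nbhd_def insert_commute)
    then show ?thesis using that
      by (auto simp: closed_nbhd_def clone_def doubleton_eq_iff insert_commute)
  qed
  have v: "closed_nbhd ?E y = closed_nbhd E v" if "y \<in> ?W" for y
  proof -
    have "u \<in> closed_nbhd E v" "v \<in> closed_nbhd E v" "y \<noteq> u"
      using assms that by (auto simp: closed_nbhd_def insert_commute)
    then show ?thesis using nx[of y] that by auto
  qed
  have sub: "?T \<union> {u} \<times> ?W \<union> insert u ?W \<times> {u} \<subseteq> twins V ?E"
  proof -
    have "?T \<subseteq> twins V ?E" using nx by (auto simp: twins_def)
    moreover have "{u} \<times> ?W \<union> insert u ?W \<times> {u} \<subseteq> twins V ?E"
      using nu v uv by (auto simp: twins_def)
    ultimately show ?thesis by blast
  qed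
  have card1: "card (twins V E) \<le> card ?T + card ({u} \<times> ?U) + card ((?U - {u}) \<times> {u})"
  proof -
    have "twins V E \<subseteq> ?T \<union> {u} \<times> ?U \<union> (?U - {u}) \<times> {u}" by (auto simp: twins_def)
    then have "card (twins V E) \<le> card (?T \<union> {u} \<times> ?U \<union> (?U - {u}) \<times> {u})"
      using fin assms(1) by (intro card_mono) (auto intro: finite_subset[OF _ fin(1)])
    also have "\<dots> \<le> card ?T + card ({u} \<times> ?U) + card ((?U - {u}) \<times> {u})"
      using card_Un_le[of "?T \<union> {u} \<times> ?U" "(?U - {u}) \<times> {u}"] card_Un_le[of ?T "{u} \<times> ?U"]
      by linarith
    finally show ?thesis .
  qed
  have card2: "card (?T \<union> {u} \<times> ?W \<union> insert u ?W \<times> {u})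
      = card ?T + card ({u} \<times> ?W) + card (insert u ?W \<times> {u})"
  proof -
    have "finite ?T" by (rule finite_subset[OF _ fin(1)]) auto
    then show ?thesis using assms(1) uW
      by (subst card_Un_disjoint, simp, simp, force, subst card_Un_disjoint, simp, simp, auto)
  qed
  have "card (?U - {u}) < card ?U"
    using uv assms(1) by (intro psubset_card_mono) auto
  moreover have "card (insert u ?W) = Suc (card ?W)" using uW assms(1) by simp
  moreover have "card (?T \<union> {u} \<times> ?W \<union> insert u ?W \<times> {u}) \<le> card (twins V ?E)"
    by (rule card_mono[OF fin(2) sub])
  moreover have "card ({u} \<times> ?U) = card ?U" "card ((?U - {u}) \<times> {u}) = card (?U - {u})"
    "card ({u} \<times> ?W) = card ?W" "card (insert u ?W \<times> {u}) = card (insert u ?W)"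
    by (simp_all only: card_cartesian_product) auto
  ultimately show ?thesis using card1 card2 assms(5) by linarith
qed

text \<open>
  One of the two cloning operations either increases the number of copies or leaves it unchanged and
  increases the number of pairs of twins.  Both numbers are bounded in terms of \<open>V\<close>.
\<close>

lemma symmetrisation_induct [consumes 2, case_names cliques step]:
  assumes "finite V" "E \<subseteq> pairs V"
    and cliques: "\<And>E. E \<subseteq> pairs V \<Longrightarrow>
      (\<And>x y. {x, y} \<in> E \<Longrightarrow> closed_nbhd E x = closed_nbhd E y) \<Longrightarrow> P E"
    and step: "\<And>E E'. E \<subseteq> pairs V \<Longrightarrow> E' \<subseteq> pairs V \<Longrightarrow>
      card (copies V E) \<le> card (copies V E') \<Longrightarrow>
      card (sym_diff E E') \<le> card V \<Longrightarrow> P E' \<Longrightarrow> P E"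
  shows "P E"
proof -
  let ?better = "\<lambda>E' E. card (copies V E) < card (copies V E') \<or>
    card (copies V E) = card (copies V E') \<and> card (twins V E) < card (twins V E')"
  define r where "r = inv_image (less_than <*lex*> less_than)
    (\<lambda>E. (card (Pow V) - card (copies V E), card (V \<times> V) - card (twins V E)))"
  have wf: "wf r" unfolding r_def by (intro wf_inv_image wf_lex_prod wf_less_than)
  have bounds: "card (copies V E) \<le> card (Pow V)" "card (twins V E) \<le> card (V \<times> V)" for E
    using assms(1) by (auto simp only: copies_def twins_def finite_Pow_iff finite_cartesian_product
        intro!: card_mono)
  have dec: "(E', E) \<in> r" if "?better E' E" for E E'
    using that bounds[of E] bounds[of E'] by (auto simp: r_def)
  show ?thesis using assms(2)
  proof (induction E rule: wf_induct_rule[OF wf])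
    case (1 E)
    show ?case
    proof (cases "\<forall>x y. {x, y} \<in> E \<longrightarrow> closed_nbhd E x = closed_nbhd E y")
      case True
      then show ?thesis using cliques 1(2) by blast
    next
      case False
      then obtain u0 v0 where uv0: "{u0, v0} \<in> E" "closed_nbhd E u0 \<noteq> closed_nbhd E v0" by blast
      obtain u v where uv: "{u, v} \<in> E" "closed_nbhd E u \<noteq> closed_nbhd E v"
        and le: "card {y \<in> V. closed_nbhd E y = closed_nbhd E u} \<le>
          card {y \<in> V. closed_nbhd E y = closed_nbhd E v}"
      proof (cases "card {y \<in> V. closed_nbhd E y = closed_nbhd E u0} \<le>
          card {y \<in> V. closed_nbhd E y = closed_nbhd E v0}")
        case True
        then show thesis using that uv0 by blast
      next
        case False
        then show thesis using that[of v0 u0] uv0 by (simp add: insert_commute)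
      qed
      have vu: "{v, u} \<in> E" using uv(1) by (simp add: insert_commute)
      have "?better (clone E u v) E \<or> ?better (clone E v u) E"
        using card_copies_clone[OF assms(1) 1(2) uv(1)]
          card_twins_clone[OF assms(1) 1(2) uv le] by linarith
      then obtain E' where E': "E' = clone E u v \<or> E' = clone E v u" "?better E' E" by blast
      have "E' \<subseteq> pairs V" "card (sym_diff E E') \<le> card V"
        using E'(1) clone_subset[OF 1(2)] card_sym_diff_clone[OF assms(1) 1(2)] uv(1) vu
        by blast+
      then show ?thesis
        using step[OF 1(2)] 1(1)[OF dec[OF E'(2)]] E'(2) by fastforce
    qed
  qed
qed


section \<open>Disjoint unions of cliques\<close>

text \<open>
  If adjacent vertices are twins, then the closed neighbourhoods are the cliques.
\<close>

lemma disjoint_cliquesE: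
  assumes "finite V" "E \<subseteq> pairs V"
    and tw: "\<And>x y. {x, y} \<in> E \<Longrightarrow> closed_nbhd E x = closed_nbhd E y"
  obtains PP where "partition_on V PP" "E = (\<Union>P\<in>PP. pairs P)"
proof
  let ?P = "closed_nbhd E ` V"
  have same: "closed_nbhd E y = closed_nbhd E x" if "y \<in> closed_nbhd E x" for x y
    using that tw by (auto simp: closed_nbhd_def)
  show "partition_on V ?P"
  proof (rule partition_onI)
    show "\<Union> ?P = V"
      using closed_nbhd_subset[OF assms(2)] by (auto simp: closed_nbhd_def)
    show "disjnt p q" if pq: "p \<in> ?P" "q \<in> ?P" "p \<noteq> q" for p q
    proof -
      have "closed_nbhd E z = r" if "z \<in> r" "r \<in> ?P" for z r
        using that same by auto
      then show ?thesis using pq unfolding disjnt_iff by metis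
    qed
    show "{} \<notin> ?P" by (auto simp: closed_nbhd_def)
  qed
  have "\<Union> (pairs ` ?P) \<subseteq> pairs V"
    using closed_nbhd_subset[OF assms(2)] pairs_mono by blast
  then show "E = \<Union> (pairs ` ?P)"
  proof (rule pairs_eqI[OF assms(2)])
    fix x y :: 'a assume ne: "x \<noteq> y"
    show "{x, y} \<in> E \<longleftrightarrow> {x, y} \<in> \<Union> (pairs ` ?P)"
    proof
      assume e: "{x, y} \<in> E"
      then have "x \<in> V" using assms(2) by auto
      moreover have "{x, y} \<in> pairs (closed_nbhd E x)"
        using e ne by (simp add: closed_nbhd_def)
      ultimately show "{x, y} \<in> \<Union> (pairs ` ?P)" by blast
    next
      assume "{x, y} \<in> \<Union> (pairs ` ?P)"
      then obtain z where "x \<in> closed_nbhd E z" "y \<in> closed_nbhd E z" by auto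
      then have "y \<in> closed_nbhd E x" using same by blast
      then show "{x, y} \<in> E" using ne by (auto simp: closed_nbhd_def)
    qed
  qed
qed

text \<open>
  The pairs that complete four vertices of the clique \<open>P\<close> to a copy.
\<close>

definition cross_pairs :: "'a set \<Rightarrow> 'a set set \<Rightarrow> 'a set \<Rightarrow> 'a set set" where
  "cross_pairs V PP P = pairs (V - P) - (\<Union>P'\<in>PP - {P}. pairs P')"

lemma partition_on_unique:
  "partition_on V PP \<Longrightarrow> P \<in> PP \<Longrightarrow> P' \<in> PP \<Longrightarrow> x \<in> P \<Longrightarrow> x \<in> P' \<Longrightarrow> P = P'"
  by (auto simp: partition_on_def disjoint_def)

lemma partition_on_subset: "partition_on V PP \<Longrightarrow> P \<in> PP \<Longrightarrow> P \<subseteq> V"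
  by (auto simp: partition_on_def)

lemma card_copies_disjoint_cliques:
  assumes "finite V" "partition_on V PP"
  shows "card (copies V (\<Union>P\<in>PP. pairs P)) \<le>
    (\<Sum>P\<in>PP. (card P choose 4) * card (cross_pairs V PP P))"
proof -
  let ?E = "\<Union>P\<in>PP. pairs P"
  let ?X = "\<lambda>P. {Q. Q \<subseteq> P \<and> card Q = 4} \<times> cross_pairs V PP P"
  have fin: "finite PP" using assms by (rule finite_elements)
  have finP: "finite P" if "P \<in> PP" for P
    using partition_on_subset[OF assms(2) that] assms(1) by (rule finite_subset)
  have finX: "finite (?X P)" if "P \<in> PP" for P
    using finP[OF that] assms(1) by (simp add: cross_pairs_def)
  have "copies V ?E \<subseteq> (\<Union>P\<in>PP. (\<lambda>(Q, R). Q \<union> R) ` ?X P)"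
  proof
    fix S assume "S \<in> copies V ?E"
    then have "S \<subseteq> V" "copy ?E S" by (simp_all add: copies_def)
    moreover from this(2) obtain Q where "Q \<subseteq> S" "card S = 6" "card Q = 4"
      "\<forall>x\<in>S. \<forall>y\<in>S. x \<noteq> y \<longrightarrow> ({x, y} \<in> ?E \<longleftrightarrow> x \<in> Q \<and> y \<in> Q)"
      by (auto simp only: copy_iff)
    ultimately have S: "S \<subseteq> V" "Q \<subseteq> S" "card S = 6" "card Q = 4"
      and R: "\<And>x y. x \<in> S \<Longrightarrow> y \<in> S \<Longrightarrow> x \<noteq> y \<Longrightarrow> {x, y} \<in> ?E \<longleftrightarrow> x \<in> Q \<and> y \<in> Q"
      by simp_all
    obtain q where q: "q \<in> Q" using S(4) by fastforce
    then obtain P where P: "P \<in> PP" "q \<in> P"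
      using S assms(2) by (auto simp: partition_on_def)
    have QP: "Q \<subseteq> P"
    proof
      fix y assume y: "y \<in> Q"
      show "y \<in> P"
      proof (cases "y = q")
        case False
        then have "{q, y} \<in> ?E" using R[of q y] q y S(2) by auto
        then show ?thesis using partition_on_unique[OF assms(2) P(1) _ P(2)] by auto
      qed (use P in simp)
    qed
    have disj: "r \<notin> P" if "r \<in> S - Q" for r
    proof
      assume "r \<in> P"
      moreover have "r \<noteq> q" using that q by blast
      ultimately have "{q, r} \<in> ?E" using P by auto
      then show False using R[of q r] q that S(2) \<open>r \<noteq> q\<close> by auto
    qed
    have "finite Q" using S(4) card.infinite by fastforce
    then have "card (S - Q) = 2" using S by (simp add: card_Diff_subset)
    then have "S - Q \<in> pairs (V - P)" using S(1) disj by (auto simp: pairs_def)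
    moreover have "S - Q \<notin> ?E"
    proof
      assume E: "S - Q \<in> ?E"
      obtain r s where rs: "S - Q = {r, s}" "r \<noteq> s" using \<open>card (S - Q) = 2\<close>
        by (auto simp: card_2_iff)
      then have "r \<in> S - Q" "s \<in> S - Q" by auto
      then show False using R[of r s] rs E by auto
    qed
    ultimately have "S - Q \<in> cross_pairs V PP P" by (auto simp: cross_pairs_def)
    then have "(Q, S - Q) \<in> ?X P" using QP S(4) by simp
    moreover have "S = Q \<union> (S - Q)" using S(2) by auto
    ultimately show "S \<in> (\<Union>P\<in>PP. (\<lambda>(Q, R). Q \<union> R) ` ?X P)"
      using P(1) by (auto intro!: bexI[of _ P] image_eqI[of _ _ "(Q, S - Q)"])
  qed
  then have "card (copies V ?E) \<le> card (\<Union>P\<in>PP. (\<lambda>(Q, R). Q \<union> R) ` ?X P)"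
    by (rule card_mono[rotated]) (use fin finX in blast)
  also have "\<dots> \<le> (\<Sum>P\<in>PP. card ((\<lambda>(Q, R). Q \<union> R) ` ?X P))"
    by (rule card_UN_le[OF fin])
  also have "\<dots> \<le> (\<Sum>P\<in>PP. card (?X P))"
    by (intro sum_mono card_image_le finX)
  also have "\<dots> = (\<Sum>P\<in>PP. (card P choose 4) * card (cross_pairs V PP P))"
    by (intro sum.cong refl) (simp add: card_cartesian_product n_subsets finP)
  finally show ?thesis .
qed

lemma real_choose_two: "real (n choose 2) = (real n)\<^sup>2 / 2 - real n / 2"
proof (induction n)
  case (Suc n)
  have "Suc n choose 2 = n + (n choose 2)" by (simp add: numeral_2_eq_2)
  then have "real (Suc n choose 2) = real n + real (n choose 2)" by simp
  then show ?case unfolding Suc by (simp add: power2_eq_square field_simps)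
qed simp

lemma card_cross_pairs:
  assumes "finite V" "partition_on V PP" "P \<in> PP"
  shows "2 * real (card (cross_pairs V PP P)) =
    (real (card V) - real (card P))\<^sup>2 - (\<Sum>P'\<in>PP - {P}. (real (card P'))\<^sup>2)"
proof -
  have fin: "finite PP" using assms(1,2) by (rule finite_elements)
  have finP: "finite P" if "P \<in> PP" for P
    using partition_on_subset[OF assms(2) that] assms(1) by (rule finite_subset)
  let ?U = "\<Union>P'\<in>PP - {P}. pairs P'"
  have disj: "P' \<inter> P'' = {}" if "P' \<in> PP" "P'' \<in> PP" "P' \<noteq> P''" for P' P''
    using that partition_on_unique[OF assms(2)] by blast
  have sub: "?U \<subseteq> pairs (V - P)"
  proof (rule UN_least)
    fix P' assume "P' \<in> PP - {P}"
    then show "pairs P' \<subseteq> pairs (V - P)"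
      using disj[of P' P] partition_on_subset[OF assms(2)] assms(3) by (intro pairs_mono) auto
  qed
  have "card (\<Union>(PP - {P})) = (\<Sum>P'\<in>PP - {P}. card P')"
    by (rule card_Union_disjoint) (use disj finP in \<open>auto simp: pairwise_def disjnt_def\<close>)
  moreover have "\<Union>(PP - {P}) = V - P"
    using assms(2,3) disj by (auto simp: partition_on_def)
  ultimately have sum1: "card (V - P) = (\<Sum>P'\<in>PP - {P}. card P')" by simp
  have "card ?U = (\<Sum>P'\<in>PP - {P}. card (pairs P'))"
  proof (rule card_UN_disjoint)
    show "\<forall>i\<in>PP - {P}. \<forall>j\<in>PP - {P}. i \<noteq> j \<longrightarrow> pairs i \<inter> pairs j = {}"
      using disj by (auto simp: pairs_Int) (auto simp: pairs_def)
  qed (use fin finP in auto)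
  also have "\<dots> = (\<Sum>P'\<in>PP - {P}. card P' choose 2)"
    by (intro sum.cong refl card_pairs finP) simp
  finally have U: "card ?U = (\<Sum>P'\<in>PP - {P}. card P' choose 2)" .
  have "card (cross_pairs V PP P) = card (pairs (V - P)) - card ?U"
    unfolding cross_pairs_def using assms(1) sub
    by (intro card_Diff_subset finite_subset[OF sub]) simp_all
  moreover have "card ?U \<le> card (pairs (V - P))"
    using assms(1) sub by (intro card_mono) simp_all
  ultimately have "real (card (cross_pairs V PP P)) = real (card (V - P) choose 2) - real (card ?U)"
    using assms(1) by (simp add: card_pairs of_nat_diff)
  also have "real (card ?U) = (\<Sum>P'\<in>PP - {P}. (real (card P'))\<^sup>2 / 2 - real (card P') / 2)"
    unfolding U of_nat_sum by (intro sum.cong refl real_choose_two)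
  also have "\<dots> = (\<Sum>P'\<in>PP - {P}. (real (card P'))\<^sup>2) / 2 - real (card (V - P)) / 2"
    unfolding sum1 by (simp add: sum_subtractf sum_divide_distrib)
  also have "real (card (V - P) choose 2) = (real (card (V - P)))\<^sup>2 / 2 - real (card (V - P)) / 2"
    by (rule real_choose_two)
  finally have "2 * real (card (cross_pairs V PP P)) =
      (real (card (V - P)))\<^sup>2 - (\<Sum>P'\<in>PP - {P}. (real (card P'))\<^sup>2)" by simp
  moreover have "real (card (V - P)) = real (card V) - real (card P)"
    using partition_on_subset[OF assms(2,3)] finP[OF assms(3)] assms(1)
    by (simp add: card_Diff_subset of_nat_diff card_mono)
  ultimately show ?thesis by simp
qed

lemma choose_le_pow_div_fact: "real (n choose k) \<le> real n ^ k / fact k"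
proof -
  have "fact k * (n choose k) \<le> n ^ k" using binomial_fact_pow[of n k] by (simp add: mult.commute)
  then have "real (fact k * (n choose k)) \<le> real (n ^ k)" by (simp only: of_nat_le_iff)
  then show ?thesis by (simp add: field_simps)
qed

lemma real_card_copies_disjoint_cliques:
  assumes "finite V" "partition_on V PP"
  shows "48 * real (card (copies V (\<Union>P\<in>PP. pairs P))) \<le>
    (\<Sum>P\<in>PP. real (card P) ^ 4 *
      ((real (card V) - real (card P))\<^sup>2 - (\<Sum>P'\<in>PP - {P}. (real (card P'))\<^sup>2)))"
proof -
  have "real (card (copies V (\<Union>P\<in>PP. pairs P))) \<le>
      (\<Sum>P\<in>PP. real (card P choose 4) * real (card (cross_pairs V PP P)))"
    using of_nat_mono[OF card_copies_disjoint_cliques[OF assms], where 'a = real] by simp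
  also have "\<dots> \<le> (\<Sum>P\<in>PP. real (card P) ^ 4 / 24 * real (card (cross_pairs V PP P)))"
    using choose_le_pow_div_fact[of _ 4]
    by (intro sum_mono mult_right_mono) (simp_all add: fact_numeral)
  finally have le: "real (card (copies V (\<Union>P\<in>PP. pairs P))) \<le>
      (\<Sum>P\<in>PP. real (card P) ^ 4 / 24 * real (card (cross_pairs V PP P)))" .
  have "48 * (\<Sum>P\<in>PP. real (card P) ^ 4 / 24 * real (card (cross_pairs V PP P))) =
      (\<Sum>P\<in>PP. real (card P) ^ 4 * (2 * real (card (cross_pairs V PP P))))"
    unfolding sum_distrib_left by (intro sum.cong) simp_all
  with le have "48 * real (card (copies V (\<Union>P\<in>PP. pairs P))) \<le>
      (\<Sum>P\<in>PP. real (card P) ^ 4 * (2 * real (card (cross_pairs V PP P))))" by linarith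
  then show ?thesis
    by (simp add: card_cross_pairs[OF assms] cong: sum.cong)
qed

text \<open>
  The left side is the square of \<open>a^2 (1 - a)\<close>, whose distance from its maximum \<open>4/27\<close> factors as
  \<open>(a - 2/3)^2 (a + 1/3)\<close>.
\<close>

lemma clique_poly_le:
  fixes a :: real
  assumes "0 \<le> a" "a \<le> 1"
  shows "a ^ 4 * (1 - a)\<^sup>2 \<le> 16 / 729 - 4 / 81 * (a - 2 / 3)\<^sup>2"
proof -
  define p where "p = a\<^sup>2 * (1 - a)"
  have p0: "0 \<le> p" using assms by (simp add: p_def)
  have p: "4 / 27 - p = (a - 2 / 3)\<^sup>2 * (a + 1 / 3)"
    unfolding p_def by algebra
  have "(a - 2 / 3)\<^sup>2 * (1 / 3) \<le> 4 / 27 - p"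
    unfolding p using assms by (intro mult_left_mono) auto
  moreover from this have "0 \<le> 4 / 27 - p"
    using zero_le_power2[of "a - 2 / 3"] by linarith
  ultimately have "(a - 2 / 3)\<^sup>2 * (1 / 3) * (4 / 27) \<le> (4 / 27 - p) * (4 / 27 + p)"
    using p0 by (intro mult_mono) auto
  moreover have "(4 / 27 - p) * (4 / 27 + p) = 16 / 729 - a ^ 4 * (1 - a)\<^sup>2"
    unfolding p_def by algebra
  ultimately show ?thesis by (simp add: field_simps)
qed

text \<open>
  The two terms compare what a further clique of size \<open>b\<close> contributes, as the clique of a copy, with
  what it costs by supplying adjacent pairs outside the largest clique, of size \<open>a\<close>; both carry a
  factor \<open>b^2\<close> that is divided out here.
\<close>

lemma other_clique_le:
  fixes a b :: real
  assumes "1 / 2 \<le> a" "0 \<le> b" "b \<le> 1 - a"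
  shows "b\<^sup>2 * ((1 - b)\<^sup>2 - a\<^sup>2) - a ^ 4 \<le> - 1 / 32"
proof -
  have "(1 / 2)\<^sup>2 \<le> a\<^sup>2" "(1 / 2) ^ 4 \<le> a ^ 4" using assms by (intro power_mono; simp)+
  then have a: "1 / 4 \<le> a\<^sup>2" "1 / 16 \<le> a ^ 4" by (simp_all add: power_divide)
  have "b * (1 / 2 - b) \<le> 1 / 16"
    using zero_le_square[of "b - 1 / 4"] by (simp add: algebra_simps)
  moreover have "b * (3 / 2 - b) \<le> 1 / 2"
  proof -
    have "0 \<le> (1 / 2 - b) * (1 - b)" using assms by (intro mult_nonneg_nonneg) auto
    moreover have "(1 / 2 - b) * (1 - b) = 1 / 2 - b * (3 / 2 - b)" by algebra
    ultimately show ?thesis by linarith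
  qed
  ultimately have "(b * (1 / 2 - b)) * (b * (3 / 2 - b)) \<le> 1 / 16 * (1 / 2)"
    using assms by (intro mult_mono) auto
  moreover have "(b * (1 / 2 - b)) * (b * (3 / 2 - b)) = b\<^sup>2 * ((1 - b)\<^sup>2 - 1 / 4)" by algebra
  moreover have "b\<^sup>2 * ((1 - b)\<^sup>2 - a\<^sup>2) \<le> b\<^sup>2 * ((1 - b)\<^sup>2 - 1 / 4)"
    using a by (intro mult_left_mono) auto
  ultimately show ?thesis using a by simp
qed

text \<open>
  The maximum of the left side on this interval is about \<open>0.0175\<close>, while \<open>16/729\<close> is about \<open>0.0219\<close>.
\<close>

lemma small_clique_poly_le:
  fixes a :: real
  assumes "0 \<le> a" "a \<le> 1 / 2"
  shows "a ^ 4 * (1 - a)\<^sup>2 + a * (1 - a) * (a\<^sup>2 * (1 - a)\<^sup>2 - a ^ 4) \<le> 16 / 729 - 1 / 500"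
proof -
  have 1: "a * (1 - a) \<le> 1 / 4"
    using zero_le_square[of "a - 1 / 2"] by (simp add: algebra_simps)
  (* tangents of a^4 and a^3 in the variable a^2, taken near the maximum at about a = 0.42 *)
  have "0 \<le> (a\<^sup>2 - 18 / 100)\<^sup>2" by simp
  also have "\<dots> = a ^ 4 - (36 / 100 * a\<^sup>2 - 324 / 10000)" by algebra
  finally have "36 / 100 * a\<^sup>2 - 324 / 10000 \<le> a ^ 4" by simp
  moreover have "63 / 100 * a\<^sup>2 - 37044 / 1000000 \<le> a ^ 3"
  proof -
    have "0 \<le> (a - 42 / 100)\<^sup>2 * (a + 21 / 100)" using assms by simp
    also have "\<dots> = a ^ 3 - (63 / 100 * a\<^sup>2 - 37044 / 1000000)" by algebra
    finally show ?thesis by simp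
  qed
  moreover have "a\<^sup>2 \<le> (1 / 2)\<^sup>2" using assms by (intro power_mono)
  ultimately have 2: "a\<^sup>2 - a ^ 3 - a ^ 4 \<le> 79 / 1000" by (simp add: power_divide)
  have "a ^ 4 * (1 - a)\<^sup>2 + a * (1 - a) * (a\<^sup>2 * (1 - a)\<^sup>2 - a ^ 4) = (a * (1 - a)) * (a\<^sup>2 - a ^ 3 - a ^ 4)"
    by algebra
  also have "\<dots> \<le> (a * (1 - a)) * (79 / 1000)"
    using assms 2 by (intro mult_left_mono) auto
  also have "\<dots> \<le> 1 / 4 * (79 / 1000)" using 1 by simp
  finally show ?thesis by simp
qed

text \<open>
  In the term of a clique other than the largest one, only the square of the largest size \<open>a\<close> is
  kept from the inner sum.  The inner sum in the term of the largest clique is distributed over the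
  other cliques, which leaves for each of them a multiple of its squared size.
\<close>

lemma cliques_sum_le:
  fixes x :: "'i \<Rightarrow> real"
  assumes "finite I" "m \<in> I" and nonneg: "\<And>i. i \<in> I \<Longrightarrow> 0 \<le> x i"
    and max: "\<And>i. i \<in> I \<Longrightarrow> x i \<le> x m" and sum: "(\<Sum>i\<in>I. x i) = 1"
  defines "L \<equiv> \<Sum>i\<in>I. x i ^ 4 * ((1 - x i)\<^sup>2 - (\<Sum>j\<in>I - {i}. (x j)\<^sup>2))"
  shows "x m < 1 / 2 \<Longrightarrow> L \<le> 16 / 729 - 1 / 500"
    and "1 / 2 \<le> x m \<Longrightarrow> L \<le> 16 / 729 - (\<Sum>j\<in>I - {m}. (x j)\<^sup>2) / 32"
proof -
  define a where "a = x m"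
  let ?J = "I - {m}"
  have a0: "0 \<le> a" using nonneg assms(2) by (simp add: a_def)
  have rest: "(\<Sum>i\<in>?J. x i) = 1 - a"
    using sum assms(1,2) by (simp add: a_def sum_diff1)
  have xle: "x i \<le> 1 - a" if "i \<in> ?J" for i
    unfolding rest[symmetric] using that assms(1) nonneg by (intro member_le_sum) auto
  have a1: "a \<le> 1"
  proof -
    have "0 \<le> (\<Sum>i\<in>?J. x i)" using nonneg by (intro sum_nonneg) auto
    then show ?thesis using rest by simp
  qed
  have "L = a ^ 4 * ((1 - a)\<^sup>2 - (\<Sum>j\<in>?J. (x j)\<^sup>2))
      + (\<Sum>i\<in>?J. x i ^ 4 * ((1 - x i)\<^sup>2 - (\<Sum>j\<in>I - {i}. (x j)\<^sup>2)))"
    unfolding L_def a_def using assms(1,2) by (simp add: sum.remove)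
  also have "\<dots> \<le> a ^ 4 * ((1 - a)\<^sup>2 - (\<Sum>j\<in>?J. (x j)\<^sup>2))
      + (\<Sum>i\<in>?J. x i ^ 4 * ((1 - x i)\<^sup>2 - a\<^sup>2))"
  proof -
    have "a\<^sup>2 \<le> (\<Sum>j\<in>I - {i}. (x j)\<^sup>2)" if "i \<in> ?J" for i
      unfolding a_def using that assms(1,2) by (intro member_le_sum[of m]) auto
    then show ?thesis by (intro add_left_mono sum_mono mult_left_mono) auto
  qed
  also have "\<dots> = a ^ 4 * (1 - a)\<^sup>2 +
      (\<Sum>i\<in>?J. (x i)\<^sup>2 * ((x i)\<^sup>2 * ((1 - x i)\<^sup>2 - a\<^sup>2) - a ^ 4))"
  proof -
    have "(\<Sum>i\<in>?J. (x i)\<^sup>2 * ((x i)\<^sup>2 * ((1 - x i)\<^sup>2 - a\<^sup>2) - a ^ 4)) =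
        (\<Sum>i\<in>?J. x i ^ 4 * ((1 - x i)\<^sup>2 - a\<^sup>2) - a ^ 4 * (x i)\<^sup>2)"
      by (intro sum.cong refl) algebra
    then show ?thesis by (simp add: sum_subtractf sum_distrib_left sum.distrib algebra_simps)
  qed
  finally have L: "L \<le> a ^ 4 * (1 - a)\<^sup>2 +
      (\<Sum>i\<in>?J. (x i)\<^sup>2 * ((x i)\<^sup>2 * ((1 - x i)\<^sup>2 - a\<^sup>2) - a ^ 4))" .
  show "L \<le> 16 / 729 - (\<Sum>j\<in>?J. (x j)\<^sup>2) / 32" if "1 / 2 \<le> x m"
  proof -
    have "(\<Sum>i\<in>?J. (x i)\<^sup>2 * ((x i)\<^sup>2 * ((1 - x i)\<^sup>2 - a\<^sup>2) - a ^ 4)) \<le>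
        (\<Sum>i\<in>?J. (x i)\<^sup>2 * (- 1 / 32))"
      using other_clique_le[of a] that xle nonneg
      by (intro sum_mono mult_left_mono) (auto simp: a_def)
    also have "\<dots> = - ((\<Sum>j\<in>?J. (x j)\<^sup>2) / 32)"
      by (simp add: sum_divide_distrib[symmetric] sum_negf)
    finally have "L \<le> a ^ 4 * (1 - a)\<^sup>2 - (\<Sum>j\<in>?J. (x j)\<^sup>2) / 32" using L by linarith
    moreover have "a ^ 4 * (1 - a)\<^sup>2 \<le> 16 / 729"
      using clique_poly_le[OF a0 a1] zero_le_power2[of "a - 2 / 3"] by linarith
    ultimately show ?thesis by linarith
  qed
  show "L \<le> 16 / 729 - 1 / 500" if small: "x m < 1 / 2"
  proof -
    let ?c = "a\<^sup>2 * (1 - a)\<^sup>2 - a ^ 4"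
    have c0: "0 \<le> ?c"
    proof -
      have "?c = a\<^sup>2 * (1 - 2 * a)" by algebra
      then show ?thesis using small by (simp add: a_def)
    qed
    have bound: "(x i)\<^sup>2 * ((1 - x i)\<^sup>2 - a\<^sup>2) - a ^ 4 \<le> ?c" if "i \<in> ?J" for i
    proof -
      have i: "0 \<le> x i" "x i \<le> a" using that nonneg max by (auto simp: a_def)
      have "0 \<le> (a - x i) * (1 - a - x i)"
        using i small by (intro mult_nonneg_nonneg) (auto simp: a_def)
      then have "x i * (1 - x i) \<le> a * (1 - a)" by (simp add: algebra_simps)
      then have "(x i * (1 - x i))\<^sup>2 \<le> (a * (1 - a))\<^sup>2"
        using i small by (intro power_mono mult_nonneg_nonneg) (auto simp: a_def)
      moreover have "0 \<le> (x i)\<^sup>2 * a\<^sup>2" by simp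
      ultimately show ?thesis unfolding power_mult_distrib right_diff_distrib[of "(x i)\<^sup>2"] by linarith
    qed
    have "(\<Sum>i\<in>?J. (x i)\<^sup>2 * ((x i)\<^sup>2 * ((1 - x i)\<^sup>2 - a\<^sup>2) - a ^ 4)) \<le> (\<Sum>i\<in>?J. (a * x i) * ?c)"
    proof (rule sum_mono)
      fix i assume i: "i \<in> ?J"
      have "(x i)\<^sup>2 * ((x i)\<^sup>2 * ((1 - x i)\<^sup>2 - a\<^sup>2) - a ^ 4) \<le> (x i)\<^sup>2 * ?c"
        using bound[OF i] by (intro mult_left_mono) auto
      also have "\<dots> \<le> (a * x i) * ?c"
        unfolding power2_eq_square[of "x i"]
        using i nonneg max c0 by (intro mult_right_mono) (auto simp: a_def)
      finally show "(x i)\<^sup>2 * ((x i)\<^sup>2 * ((1 - x i)\<^sup>2 - a\<^sup>2) - a ^ 4) \<le> (a * x i) * ?c" .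
    qed
    also have "\<dots> = a * (1 - a) * ?c"
      unfolding rest[symmetric] by (simp add: sum_distrib_left sum_distrib_right)
    finally show ?thesis
      using L small_clique_poly_le[OF a0] small by (simp add: a_def)
  qed
qed

text \<open>
  The pairs inside the cliques other than the largest one \<open>A\<close> are all that separates a union of
  cliques from the clique on \<open>A\<close> with isolated vertices; their number is at most half the sum of the
  squares of the sizes of these cliques, which is what \<open>cliques_sum_le\<close> controls.
\<close>

lemma disjoint_cliques_near_clique:
  assumes "finite V" "V \<noteq> {}" "partition_on V PP"
  defines "E \<equiv> \<Union>P\<in>PP. pairs P" and "n \<equiv> real (card V)"
  obtains "48 * real (card (copies V E)) \<le> (16 / 729 - 1 / 500) * n ^ 6"
  | A where "A \<subseteq> V"
    "48 * real (card (copies V E)) \<le> 16 / 729 * n ^ 6 - n ^ 4 / 16 * real (card (sym_diff E (pairs A)))"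
proof -
  have n: "0 < n" using assms(1,2) by (simp add: n_def card_gt_0_iff)
  have fin: "finite PP" using assms(1,3) by (rule finite_elements)
  have finP: "finite P" if "P \<in> PP" for P
    using partition_on_subset[OF assms(3) that] assms(1) by (rule finite_subset)
  have "PP \<noteq> {}" using assms(2,3) by (auto simp: partition_on_def)
  then have "Max (card ` PP) \<in> card ` PP" using fin by (intro Max_in) auto
  then obtain A where A: "A \<in> PP" "card A = Max (card ` PP)" by auto
  have max: "card P \<le> card A" if "P \<in> PP" for P
    unfolding A(2) using fin that by simp
  define x where "x = (\<lambda>P :: 'a set. real (card P) / n)"
  have card: "real (card P) = n * x P" for P using n by (simp add: x_def)
  have "card (\<Union>PP) = (\<Sum>P\<in>PP. card P)"
  proof (rule card_Union_disjoint)
    show "pairwise disjnt PP" using assms(3) by (simp add: partition_on_def)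
  qed (rule finP)
  then have "card V = (\<Sum>P\<in>PP. card P)" using assms(3) by (simp add: partition_on_def)
  then have "n = (\<Sum>P\<in>PP. real (card P))" unfolding n_def by simp
  then have sum: "(\<Sum>P\<in>PP. x P) = 1" using n by (simp add: x_def flip: sum_divide_distrib)
  have x: "\<And>P. P \<in> PP \<Longrightarrow> 0 \<le> x P" "\<And>P. P \<in> PP \<Longrightarrow> x P \<le> x A"
    using n max by (auto simp: x_def divide_right_mono)
  have scale: "(n * p) ^ 4 * ((n - n * p)\<^sup>2 - n\<^sup>2 * t) = n ^ 6 * (p ^ 4 * ((1 - p)\<^sup>2 - t))"
    for p t :: real by algebra
  define L where "L = (\<Sum>P\<in>PP. x P ^ 4 * ((1 - x P)\<^sup>2 - (\<Sum>P'\<in>PP - {P}. (x P')\<^sup>2)))"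
  have "48 * real (card (copies V E)) \<le> (\<Sum>P\<in>PP. real (card P) ^ 4 *
      ((n - real (card P))\<^sup>2 - (\<Sum>P'\<in>PP - {P}. (real (card P'))\<^sup>2)))"
    unfolding E_def n_def by (rule real_card_copies_disjoint_cliques[OF assms(1,3)])
  also have "\<dots> = (\<Sum>P\<in>PP. n ^ 6 * (x P ^ 4 * ((1 - x P)\<^sup>2 - (\<Sum>P'\<in>PP - {P}. (x P')\<^sup>2))))"
  proof (rule sum.cong[OF refl])
    fix P
    have "(\<Sum>P'\<in>PP - {P}. (n * x P')\<^sup>2) = n\<^sup>2 * (\<Sum>P'\<in>PP - {P}. (x P')\<^sup>2)"
      by (simp add: power_mult_distrib sum_distrib_left)
    then show "real (card P) ^ 4 * ((n - real (card P))\<^sup>2 - (\<Sum>P'\<in>PP - {P}. (real (card P'))\<^sup>2))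
        = n ^ 6 * (x P ^ 4 * ((1 - x P)\<^sup>2 - (\<Sum>P'\<in>PP - {P}. (x P')\<^sup>2)))"
      unfolding card by (simp only: scale)
  qed
  also have "\<dots> = n ^ 6 * L" unfolding L_def by (simp add: sum_distrib_left)
  finally have L: "48 * real (card (copies V E)) \<le> n ^ 6 * L" .
  show thesis
  proof (cases "x A < 1 / 2")
    case True
    then have "n ^ 6 * L \<le> n ^ 6 * (16 / 729 - 1 / 500)"
      using cliques_sum_le(1)[OF fin A(1) x sum] n by (intro mult_left_mono) (auto simp: L_def)
    then show thesis using that(1) L by (simp add: mult.commute)
  next
    case False
    have "sym_diff E (pairs A) \<subseteq> (\<Union>P\<in>PP - {A}. pairs P)"
      using A(1) by (auto simp: E_def)
    then have "card (sym_diff E (pairs A)) \<le> card (\<Union>P\<in>PP - {A}. pairs P)"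
      by (rule card_mono[rotated]) (use fin finP in auto)
    also have "\<dots> \<le> (\<Sum>P\<in>PP - {A}. card (pairs P))"
      using fin by (intro card_UN_le) simp
    finally have "real (card (sym_diff E (pairs A))) \<le> (\<Sum>P\<in>PP - {A}. real (card (pairs P)))"
      by (metis of_nat_mono of_nat_sum)
    also have "\<dots> \<le> (\<Sum>P\<in>PP - {A}. (n * x P)\<^sup>2 / 2)"
      using finP by (intro sum_mono) (simp add: card_pairs real_choose_two flip: card)
    also have "\<dots> = n\<^sup>2 * (\<Sum>P\<in>PP - {A}. (x P)\<^sup>2) / 2"
      by (simp add: power_mult_distrib sum_distrib_left sum_divide_distrib)
    finally have "n ^ 4 / 16 * real (card (sym_diff E (pairs A))) \<le>
        n ^ 4 / 16 * (n\<^sup>2 * (\<Sum>P\<in>PP - {A}. (x P)\<^sup>2) / 2)"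
      using n by (intro mult_left_mono) auto
    also have "\<dots> = n ^ 6 * ((\<Sum>P\<in>PP - {A}. (x P)\<^sup>2) / 32)"
      by (simp add: power_add[symmetric] algebra_simps)
    finally have D: "n ^ 4 / 16 * real (card (sym_diff E (pairs A))) \<le>
        n ^ 6 * ((\<Sum>P\<in>PP - {A}. (x P)\<^sup>2) / 32)" .
    have "n ^ 6 * L \<le> n ^ 6 * (16 / 729 - (\<Sum>P\<in>PP - {A}. (x P)\<^sup>2) / 32)"
      using cliques_sum_le(2)[OF fin A(1) x sum] n False
      by (intro mult_left_mono) (auto simp: L_def)
    also have "\<dots> = 16 / 729 * n ^ 6 - n ^ 6 * ((\<Sum>P\<in>PP - {A}. (x P)\<^sup>2) / 32)"
      by (simp add: algebra_simps)
    finally show thesis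
      using L D that(2)[OF partition_on_subset[OF assms(3) A(1)]] by linarith
  qed
qed

lemma card_copies_le:
  assumes "finite V" "E \<subseteq> pairs V"
  shows "real (card (copies V E)) \<le> real (card V) ^ 6 / 2187"
  using assms
proof (induction rule: symmetrisation_induct)
  case (cliques E)
  show ?case
  proof (cases "V = {}")
    case True
    then have "copies V E = {}" by (auto simp: copies_def copy_def)
    then show ?thesis by simp
  next
    case False
    obtain PP where PP: "partition_on V PP" "E = (\<Union>P\<in>PP. pairs P)"
      using disjoint_cliquesE[OF assms(1) cliques] by blast
    let ?n = "real (card V)"
    have n: "0 \<le> ?n ^ 6" by simp
    have "48 * real (card (copies V E)) \<le> 16 / 729 * ?n ^ 6"
    proof (rule disjoint_cliques_near_clique[OF assms(1) False PP(1)])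
      assume "48 * real (card (copies V (\<Union>P\<in>PP. pairs P))) \<le> (16 / 729 - 1 / 500) * ?n ^ 6"
      then show ?thesis using n by (simp add: PP(2) left_diff_distrib)
    next
      fix A
      let ?d = "real (card (sym_diff (\<Union>P\<in>PP. pairs P) (pairs A)))"
      assume "48 * real (card (copies V (\<Union>P\<in>PP. pairs P))) \<le> 16 / 729 * ?n ^ 6 - ?n ^ 4 / 16 * ?d"
      moreover have "0 \<le> ?n ^ 4 / 16 * ?d" by simp
      ultimately show ?thesis unfolding PP(2) by linarith
    qed
    then show ?thesis by simp
  qed
next
  case (step E E')
  from of_nat_mono[OF step(3), where 'a = real] step(5) show ?case by linarith
qed


section \<open>Distance to a clique with isolated vertices\<close>

definition clique_dist :: "'a set \<Rightarrow> 'a set set \<Rightarrow> nat" where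
  "clique_dist V E = Min ((\<lambda>A. card (sym_diff E (pairs A))) ` Pow V)"

lemma clique_dist_le: "finite V \<Longrightarrow> A \<subseteq> V \<Longrightarrow> clique_dist V E \<le> card (sym_diff E (pairs A))"
  unfolding clique_dist_def by (rule Min_le) auto

lemma clique_distE:
  assumes "finite V"
  obtains A where "A \<subseteq> V" "clique_dist V E = card (sym_diff E (pairs A))"
proof -
  have "clique_dist V E \<in> (\<lambda>A. card (sym_diff E (pairs A))) ` Pow V"
    unfolding clique_dist_def using assms by (intro Min_in) auto
  then show thesis using that by blast
qed

lemma clique_dist_triangle:
  assumes "finite V" "E \<subseteq> pairs V" "E' \<subseteq> pairs V"
  shows "clique_dist V E \<le> clique_dist V E' + card (sym_diff E E')"
proof -
  obtain A where A: "A \<subseteq> V" "clique_dist V E' = card (sym_diff E' (pairs A))"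
    using clique_distE[OF assms(1)] by blast
  have fin: "finite (E \<union> E' \<union> pairs A)"
    using assms A(1) by (meson finite_pairs finite_subset infinite_Un)
  have "clique_dist V E \<le> card (sym_diff E (pairs A))"
    by (rule clique_dist_le[OF assms(1) A(1)])
  also have "\<dots> \<le> card (sym_diff E' (pairs A) \<union> sym_diff E E')"
    by (rule card_mono) (use fin in auto)
  also have "\<dots> \<le> clique_dist V E' + card (sym_diff E E')"
    unfolding A(2) by (rule card_Un_le)
  finally show ?thesis .
qed

lemma choose_le_pow: "n choose k \<le> n ^ k"
proof -
  have "(n choose k) * 1 \<le> (n choose k) * fact k" by (intro mult_le_mono2 fact_ge_1)
  also have "\<dots> \<le> n ^ k" by (rule binomial_fact_pow)
  finally show ?thesis by simp
qed

lemma card_supersets_le: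
  assumes "finite V" "finite T"
  shows "card {S. T \<subseteq> S \<and> S \<subseteq> V \<and> card S = k} \<le> card V ^ (k - card T)"
proof -
  have "card {S. T \<subseteq> S \<and> S \<subseteq> V \<and> card S = k} \<le> card {R. R \<subseteq> V \<and> card R = k - card T}"
  proof (rule card_inj_on_le)
    show "inj_on (\<lambda>S. S - T) {S. T \<subseteq> S \<and> S \<subseteq> V \<and> card S = k}"
      by (rule inj_onI) blast
    show "(\<lambda>S. S - T) ` {S. T \<subseteq> S \<and> S \<subseteq> V \<and> card S = k} \<subseteq> {R. R \<subseteq> V \<and> card R = k - card T}"
      using assms(2) by (auto simp: card_Diff_subset)
    show "finite {R. R \<subseteq> V \<and> card R = k - card T}" using assms(1) by simp
  qed
  also have "\<dots> = card V choose (k - card T)" using assms(1) by (simp add: n_subsets)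
  also have "\<dots> \<le> card V ^ (k - card T)" by (rule choose_le_pow)
  finally show ?thesis .
qed

lemma card_extensions:
  assumes "finite V" "A \<subseteq> V" "T \<subseteq> V"
  shows "card {S. T \<subseteq> S \<and> S \<subseteq> V \<and> card (S \<inter> A) = card (T \<inter> A) + i \<and> card (S - A) = card (T - A) + j}
    = (card (A - T) choose i) * (card (V - A - T) choose j)" (is "card ?X = _")
proof -
  let ?Y = "{X. X \<subseteq> A - T \<and> card X = i} \<times> {Y. Y \<subseteq> V - A - T \<and> card Y = j}"
  have fin: "finite S" if "S \<subseteq> V" for S using that assms(1) by (rule finite_subset)
  have "bij_betw (\<lambda>S. (S \<inter> A - T, S - A - T)) ?X ?Y"
  proof (rule bij_betw_byWitness[where f' = "\<lambda>(X, Y). T \<union> X \<union> Y"])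
    show "\<forall>S\<in>?X. (\<lambda>(X, Y). T \<union> X \<union> Y) (S \<inter> A - T, S - A - T) = S" by auto
    show "\<forall>p\<in>?Y. (\<lambda>S. (S \<inter> A - T, S - A - T)) ((\<lambda>(X, Y). T \<union> X \<union> Y) p) = p"
      using assms(2) by auto
    show "(\<lambda>S. (S \<inter> A - T, S - A - T)) ` ?X \<subseteq> ?Y"
    proof (rule image_subsetI)
      fix S assume S: "S \<in> ?X"
      then have 1: "S \<inter> A - T = S \<inter> A - T \<inter> A" "S - A - T = S - A - (T - A)" by auto
      have "card (S \<inter> A - T) = i"
        unfolding 1(1) using S fin assms(3) by (subst card_Diff_subset) auto
      moreover have "card (S - A - T) = j"
        unfolding 1(2) using S fin assms(3) by (subst card_Diff_subset) auto
      ultimately show "(S \<inter> A - T, S - A - T) \<in> ?Y" using S by auto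
    qed
    show "(\<lambda>(X, Y). T \<union> X \<union> Y) ` ?Y \<subseteq> ?X"
    proof (rule image_subsetI)
      fix p assume "p \<in> ?Y"
      then obtain X Y where p: "p = (X, Y)" and XY: "X \<subseteq> A - T" "Y \<subseteq> V - A - T"
        and cards: "card X = i" "card Y = j" by auto
      have 2: "(T \<union> X \<union> Y) \<inter> A = (T \<inter> A) \<union> X" "(T \<union> X \<union> Y) - A = (T - A) \<union> Y"
        using XY assms(2) by auto
      have "X \<subseteq> V" "Y \<subseteq> V" using XY assms(2) by auto
      then have "finite X" "finite Y" "finite T" using assms(3) by (auto intro: fin)
      then have "card ((T \<inter> A) \<union> X) = card (T \<inter> A) + i" "card ((T - A) \<union> Y) = card (T - A) + j"
        using XY cards by (subst card_Un_disjoint; auto)+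
      then show "(\<lambda>(X, Y). T \<union> X \<union> Y) p \<in> ?X"
        unfolding p prod.case mem_Collect_eq 2 using XY assms by auto
    qed
  qed
  then have "card ?X = card ?Y" by (rule bij_betw_same_card)
  then show ?thesis
    using fin assms(2) by (simp add: card_cartesian_product n_subsets)
qed

lemma copies_pairs:
  assumes "finite V"
  shows "copies V (pairs A) = {S. S \<subseteq> V \<and> card (S \<inter> A) = 4 \<and> card (S - A) = 2}"
proof (intro equalityI subsetI)
  fix S assume "S \<in> copies V (pairs A)"
  then obtain Q where S: "S \<subseteq> V" "Q \<subseteq> S" "card S = 6" "card Q = 4" "pairs (A \<inter> S) = pairs Q"
    by (auto simp: copies_def copy_def pairs_Int)
  have "Q = S \<inter> A" using pairs_inject[OF S(5)[symmetric]] S(4) by auto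
  moreover have "card S = card (S \<inter> A) + card (S - A)"
    using finite_subset[OF S(1) assms] by (metis card_Int_Diff)
  ultimately show "S \<in> {S. S \<subseteq> V \<and> card (S \<inter> A) = 4 \<and> card (S - A) = 2}" using S by auto
next
  fix S assume S: "S \<in> {S. S \<subseteq> V \<and> card (S \<inter> A) = 4 \<and> card (S - A) = 2}"
  then have "finite S" using assms finite_subset by auto
  then have "card S = 6" using S card_Int_Diff[of S A] by auto
  then show "S \<in> copies V (pairs A)"
    using S by (auto simp: copies_def copy_def pairs_Int Int_commute intro!: exI[of _ "S \<inter> A"])
qed

lemma card_copies_pairs_at:
  assumes "finite V" "A \<subseteq> V" "T \<subseteq> V" "card (T \<inter> A) + i = 4" "card (T - A) + j = 2"
  shows "card {S \<in> copies V (pairs A). T \<subseteq> S} = (card (A - T) choose i) * (card (V - A - T) choose j)"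
  unfolding card_extensions[OF assms(1-3), symmetric] copies_pairs[OF assms(1)] assms(4,5)
  by (rule arg_cong[of _ _ card]) auto

lemma card_copies_pairs:
  assumes "finite V" "A \<subseteq> V"
  shows "card (copies V (pairs A)) = (card A choose 4) * (card (V - A) choose 2)"
  using card_copies_pairs_at[OF assms, of "{}" 4 2] by simp

section \<open>Correcting the wrong pairs that contain a given set\<close>

text \<open>
  \<open>W\<close> is the set of wrong pairs of a graph and the wrong pairs that contain \<open>T\<close> are about to be corrected.
  A set \<open>S\<close> is clean if no wrong pair in \<open>S\<close> remains afterwards.
\<close>

definition clean :: "'a set set \<Rightarrow> 'a set \<Rightarrow> 'a set \<Rightarrow> bool" where
  "clean W T S \<longleftrightarrow> (\<forall>f\<in>W. f \<subseteq> S \<longrightarrow> T \<subseteq> f)"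

text \<open>
  The correction changes no pair inside a set that does not contain \<open>T\<close>, and on a clean set the
  corrected graph agrees with the clique on \<open>A\<close>.  The sets that contain \<open>T\<close> and are not clean enter
  twice: they may be copies that the correction destroys, or copies in the clique on \<open>A\<close> that it does
  not produce.
\<close>

lemma card_copies_correct:
  assumes "finite V" and W: "W = sym_diff E (pairs A)" and U: "U = {f \<in> W. T \<subseteq> f}"
  shows "card (copies V E) + card {S \<in> copies V (pairs A). T \<subseteq> S} \<le>
    card (copies V (sym_diff E U)) + card {S \<in> copies V E. T \<subseteq> S \<and> clean W T S}
    + 2 * card {S. T \<subseteq> S \<and> S \<subseteq> V \<and> card S = 6 \<and> \<not> clean W T S}"
proof -
  let ?D = "{S. T \<subseteq> S \<and> S \<subseteq> V \<and> card S = 6 \<and> \<not> clean W T S}"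
  let ?E = "sym_diff E U"
  have fin: "finite ?D" using assms(1) by (auto intro: finite_subset[of _ "Pow V"])
  have six: "S \<subseteq> V \<and> card S = 6" if "S \<in> copies V F" for S F
    using that by (auto simp: copies_def copy_def)
  have away: "copy ?E S \<longleftrightarrow> copy E S" if "\<not> T \<subseteq> S" for S
  proof (rule copy_cong)
    have "U \<inter> pairs S = {}" using that by (auto simp: U pairs_def)
    then show "?E \<inter> pairs S = E \<inter> pairs S" by blast
  qed
  have corrected: "copy ?E S \<longleftrightarrow> copy (pairs A) S" if "clean W T S" for S
  proof (rule copy_cong)
    have "W \<inter> pairs S = U \<inter> pairs S" using that by (auto simp: U clean_def pairs_def)
    then show "?E \<inter> pairs S = pairs A \<inter> pairs S" unfolding W by blast
  qed
  have split: "card (copies V F) = card {S \<in> copies V F. \<not> T \<subseteq> S} + card {S \<in> copies V F. T \<subseteq> S}" for F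
  proof -
    have "copies V F = {S \<in> copies V F. \<not> T \<subseteq> S} \<union> {S \<in> copies V F. T \<subseteq> S}" by auto
    then show ?thesis
      by (metis (no_types, lifting) card_Un_disjoint disjoint_iff finite_copies finite_Un
          mem_Collect_eq assms(1))
  qed
  have "card {S \<in> copies V ?E. \<not> T \<subseteq> S} = card {S \<in> copies V E. \<not> T \<subseteq> S}"
    using away by (intro arg_cong[of _ _ card]) (auto simp: copies_def)
  moreover have "card {S \<in> copies V E. T \<subseteq> S} \<le>
      card ({S \<in> copies V E. T \<subseteq> S \<and> clean W T S} \<union> ?D)"
    by (rule card_mono) (use assms(1) fin six in auto)
  moreover have "card ({S \<in> copies V E. T \<subseteq> S \<and> clean W T S} \<union> ?D) \<le>
      card {S \<in> copies V E. T \<subseteq> S \<and> clean W T S} + card ?D" by (rule card_Un_le)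
  moreover have "card {S \<in> copies V (pairs A). T \<subseteq> S} \<le> card ({S \<in> copies V ?E. T \<subseteq> S} \<union> ?D)"
  proof (rule card_mono)
    show "{S \<in> copies V (pairs A). T \<subseteq> S} \<subseteq> {S \<in> copies V ?E. T \<subseteq> S} \<union> ?D"
      using corrected six by (auto simp: copies_def)
  qed (use assms(1) fin in auto)
  moreover have "card ({S \<in> copies V ?E. T \<subseteq> S} \<union> ?D) \<le> card {S \<in> copies V ?E. T \<subseteq> S} + card ?D"
    by (rule card_Un_le)
  ultimately show ?thesis using split[of E] split[of ?E] by linarith
qed

lemma card_unclean_le:
  assumes "finite V" "finite W" "finite T"
  shows "card {S. T \<subseteq> S \<and> S \<subseteq> V \<and> card S = 6 \<and> \<not> clean W T S} \<le>
    (\<Sum>f\<in>{f \<in> W. f \<subseteq> V \<and> \<not> T \<subseteq> f}. card V ^ (6 - card (T \<union> f)))"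
proof -
  let ?B = "\<lambda>f. {S. T \<union> f \<subseteq> S \<and> S \<subseteq> V \<and> card S = 6}"
  let ?F = "{f \<in> W. f \<subseteq> V \<and> \<not> T \<subseteq> f}"
  have "card {S. T \<subseteq> S \<and> S \<subseteq> V \<and> card S = 6 \<and> \<not> clean W T S} \<le> card (\<Union>f\<in>?F. ?B f)"
  proof (rule card_mono)
    show "finite (\<Union>f\<in>?F. ?B f)" using assms by (auto intro: finite_subset[of _ "Pow V"])
    show "{S. T \<subseteq> S \<and> S \<subseteq> V \<and> card S = 6 \<and> \<not> clean W T S} \<subseteq> (\<Union>f\<in>?F. ?B f)"
      unfolding clean_def by blast
  qed
  also have "\<dots> \<le> (\<Sum>f\<in>?F. card (?B f))" using assms(2) by (intro card_UN_le) simp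
  also have "\<dots> \<le> (\<Sum>f\<in>?F. card V ^ (6 - card (T \<union> f)))"
    using assms by (intro sum_mono card_supersets_le) (auto intro: finite_subset[of _ V])
  finally show ?thesis .
qed

lemma card_unclean_vertex_le:
  assumes "finite V" "W \<subseteq> pairs V"
  shows "card {S. {v} \<subseteq> S \<and> S \<subseteq> V \<and> card S = 6 \<and> \<not> clean W {v} S} \<le> card W * card V ^ 3"
proof -
  have finW: "finite W" using assms by (meson finite_pairs finite_subset)
  have "card {S. {v} \<subseteq> S \<and> S \<subseteq> V \<and> card S = 6 \<and> \<not> clean W {v} S} \<le>
      (\<Sum>f\<in>{f \<in> W. f \<subseteq> V \<and> \<not> {v} \<subseteq> f}. card V ^ (6 - card ({v} \<union> f)))"
    by (rule card_unclean_le) (use assms finW in auto)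
  also have "\<dots> = (\<Sum>f\<in>{f \<in> W. f \<subseteq> V \<and> \<not> {v} \<subseteq> f}. card V ^ 3)"
  proof (rule sum.cong[OF refl])
    fix f assume f: "f \<in> {f \<in> W. f \<subseteq> V \<and> \<not> {v} \<subseteq> f}"
    then have "card f = 2" "finite f" using assms by (auto simp: pairs_def intro: finite_subset)
    then have "card ({v} \<union> f) = 3" using f by simp
    then show "card V ^ (6 - card ({v} \<union> f)) = card V ^ 3" by simp
  qed
  also have "\<dots> \<le> (\<Sum>f\<in>W. card V ^ 3)" using finW by (intro sum_mono2) auto
  finally show ?thesis by simp
qed

text \<open>
  A further wrong pair either meets \<open>{x, y}\<close>, leaving three free vertices of \<open>S\<close>, or is disjoint from
  it, leaving two.
\<close>

lemma card_unclean_pair_le: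
  assumes "finite V" "W \<subseteq> pairs V" "x \<noteq> y"
  shows "card {S. {x, y} \<subseteq> S \<and> S \<subseteq> V \<and> card S = 6 \<and> \<not> clean W {x, y} S} \<le>
    (card {f \<in> W. x \<in> f} + card {f \<in> W. y \<in> f}) * card V ^ 3 + card W * card V ^ 2"
proof -
  have finW: "finite W" using assms by (meson finite_pairs finite_subset)
  let ?F = "{f \<in> W. f \<subseteq> V \<and> \<not> {x, y} \<subseteq> f}"
  let ?n = "card V"
  have "card {S. {x, y} \<subseteq> S \<and> S \<subseteq> V \<and> card S = 6 \<and> \<not> clean W {x, y} S} \<le>
      (\<Sum>f\<in>?F. ?n ^ (6 - card ({x, y} \<union> f)))"
    by (rule card_unclean_le) (use assms finW in auto)
  also have "\<dots> \<le> (\<Sum>f\<in>?F. (if x \<in> f then ?n ^ 3 else 0) + (if y \<in> f then ?n ^ 3 else 0) + ?n ^ 2)"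
  proof (rule sum_mono)
    fix f assume f: "f \<in> ?F"
    then have "card f = 2" using assms by (auto simp: pairs_def)
    then obtain a b where ab: "f = {a, b}" "a \<noteq> b" by (auto simp: card_2_iff)
    show "?n ^ (6 - card ({x, y} \<union> f)) \<le>
        (if x \<in> f then ?n ^ 3 else 0) + (if y \<in> f then ?n ^ 3 else 0) + ?n ^ 2"
    proof (cases "x \<in> f \<or> y \<in> f")
      case True
      then have "card ({x, y} \<union> f) = 3" using ab f assms(3) by (auto simp: card_insert_if)
      then show ?thesis using True by auto
    next
      case False
      then have "card ({x, y} \<union> f) = 4" using ab assms(3) by auto
      then show ?thesis by simp
    qed
  qed
  also have "\<dots> \<le> (\<Sum>f\<in>W. (if x \<in> f then ?n ^ 3 else 0) + (if y \<in> f then ?n ^ 3 else 0) + ?n ^ 2)"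
    using finW by (intro sum_mono2) auto
  also have "\<dots> = (card {f \<in> W. x \<in> f} + card {f \<in> W. y \<in> f}) * ?n ^ 3 + card W * ?n ^ 2"
    using finW by (simp add: sum.distrib sum.If_cases Int_def algebra_simps)
  finally show ?thesis .
qed

text \<open>
  Changing one pair never turns a clique with isolated vertices into a clique on four vertices with
  isolated vertices: two vertices of the four-clique outside the pair witness which vertices of the
  pair are in the clique, and so determine the pair.
\<close>

lemma no_clean_copy_at_wrong_pair:
  assumes W: "W = sym_diff E (pairs A)" and e: "{x, y} \<in> W" "x \<noteq> y"
    and S: "{x, y} \<subseteq> S" "clean W {x, y} S"
  shows "\<not> copy E S"
proof
  assume "copy E S"
  then obtain Q where Q: "Q \<subseteq> S" "card Q = 4"
    and R: "\<And>a b. a \<in> S \<Longrightarrow> b \<in> S \<Longrightarrow> a \<noteq> b \<Longrightarrow> {a, b} \<in> E \<longleftrightarrow> a \<in> Q \<and> b \<in> Q"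
    unfolding copy_iff by blast
  have "\<not> Q \<subseteq> {x, y}"
  proof
    assume "Q \<subseteq> {x, y}"
    then have "card Q \<le> card {x, y}" by (intro card_mono) auto
    then show False using Q(2) e(2) by simp
  qed
  then obtain q where q: "q \<in> Q" "q \<noteq> x" "q \<noteq> y" by auto
  have other: "{a, b} \<in> E \<longleftrightarrow> a \<in> A \<and> b \<in> A" if "a \<in> S" "b \<in> S" "a \<noteq> b" "{a, b} \<noteq> {x, y}" for a b
  proof -
    have "{a, b} \<notin> W"
    proof
      assume "{a, b} \<in> W"
      moreover have "{a, b} \<subseteq> S" using that by simp
      ultimately have "{x, y} \<subseteq> {a, b}" using S(2) unfolding clean_def by blast
      then show False using that e(2) by auto
    qed
    then show ?thesis using that unfolding W by auto
  qed
  have qS: "q \<in> S" "x \<in> S" "y \<in> S" using q Q S by auto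
  have x: "x \<in> Q \<longleftrightarrow> q \<in> A \<and> x \<in> A"
    using other[of q x] R[of q x] q qS by (auto simp: doubleton_eq_iff)
  have y: "y \<in> Q \<longleftrightarrow> q \<in> A \<and> y \<in> A"
    using other[of q y] R[of q y] q qS by (auto simp: doubleton_eq_iff)
  have "q \<in> A"
  proof -
    have "\<not> Q \<subseteq> {x, y, q}"
    proof
      assume "Q \<subseteq> {x, y, q}"
      then have "card Q \<le> card {x, y, q}" by (intro card_mono) auto
      then show False using Q(2) e(2) q by simp
    qed
    then obtain r where r: "r \<in> Q" "r \<noteq> x" "r \<noteq> y" "r \<noteq> q" by auto
    then show ?thesis using other[of q r] R[of q r] q qS Q(1) by (auto simp: doubleton_eq_iff)
  qed
  then have "{x, y} \<in> E \<longleftrightarrow> {x, y} \<in> pairs A"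
    using x y R[of x y] qS e(2) by auto
  then show False using e(1) unfolding W by auto
qed

text \<open>
  Away from \<open>v\<close>, such a copy is a clique inside \<open>A\<close> with isolated vertices outside \<open>A\<close>.  Either \<open>v\<close> is the
  fourth vertex of the clique, or it is the second isolated vertex.
\<close>

lemma card_clean_copies_vertex:
  fixes v :: 'a
  assumes "finite V" "A \<subseteq> V" and W: "W = sym_diff E (pairs A)"
  defines "N \<equiv> {x. {v, x} \<in> E}"
  shows "card {S \<in> copies V E. {v} \<subseteq> S \<and> clean W {v} S} \<le>
    (card (A \<inter> N) choose 3) * (card (V - A - insert v N) choose 2)
    + (card (A - insert v N) choose 4) * card (V - A - insert v N)"
proof -
  let ?Z = "V - A - insert v N"
  let ?X1 = "{X. X \<subseteq> A \<inter> N \<and> card X = 3} \<times> {Y. Y \<subseteq> ?Z \<and> card Y = 2}"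
  let ?X2 = "{X. X \<subseteq> A - insert v N \<and> card X = 4} \<times> {Y. Y \<subseteq> ?Z \<and> card Y = 1}"
  let ?f = "\<lambda>(X, Y). insert v (X \<union> Y)"
  have finA: "finite A" using assms(1,2) finite_subset by blast
  have fin: "finite ?X1" "finite ?X2" using assms(1) finA by auto
  have "{S \<in> copies V E. {v} \<subseteq> S \<and> clean W {v} S} \<subseteq> ?f ` ?X1 \<union> ?f ` ?X2"
  proof
    fix S assume "S \<in> {S \<in> copies V E. {v} \<subseteq> S \<and> clean W {v} S}"
    then have S: "S \<subseteq> V" "v \<in> S" "clean W {v} S" "copy E S" by (auto simp: copies_def)
    obtain Q where Q: "Q \<subseteq> S" "card S = 6" "card Q = 4" "E \<inter> pairs S = pairs Q"
      using S(4) unfolding copy_def by blast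
    have finS: "finite S" "finite Q" using S(1) Q(1) assms(1) by (meson finite_subset)+
    let ?S = "S - {v}"
    have "W \<inter> pairs ?S = {}" using S(3) by (auto simp: clean_def pairs_def)
    then have "E \<inter> pairs ?S = pairs A \<inter> pairs ?S" unfolding W by blast
    moreover have "E \<inter> pairs ?S = (E \<inter> pairs S) \<inter> pairs ?S" using pairs_mono[of ?S S] by blast
    ultimately have "pairs (Q \<inter> ?S) = pairs (A \<inter> ?S)" unfolding Q(4) pairs_Int by simp
    moreover have "Q \<inter> ?S = Q - {v}" using Q(1) by auto
    moreover have "card (Q - {v}) \<ge> 2" using Q(3) finS by (simp add: card_Diff_singleton_if)
    ultimately have QA: "Q - {v} = A \<inter> ?S" using pairs_inject[of "Q - {v}"] by simp
    have nb: "x \<in> N \<longleftrightarrow> v \<in> Q \<and> x \<in> Q" if "x \<in> S" "x \<noteq> v" for x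
    proof -
      have "x \<in> N \<longleftrightarrow> {v, x} \<in> E \<inter> pairs S" using that S(2) by (auto simp: N_def)
      then show ?thesis unfolding Q(4) using that by auto
    qed
    show "S \<in> ?f ` ?X1 \<union> ?f ` ?X2"
    proof (cases "v \<in> Q")
      case True
      have "card (Q - {v}) = 3" "card (S - Q) = 2"
        using True Q finS by (simp_all add: card_Diff_subset)
      moreover have "Q - {v} \<subseteq> A \<inter> N" using QA nb True Q(1) by auto
      moreover have "S - Q \<subseteq> ?Z" using QA nb True S(1) by auto
      ultimately have "(Q - {v}, S - Q) \<in> ?X1" by simp
      moreover have "S = ?f (Q - {v}, S - Q)" using True Q(1) by auto
      ultimately show ?thesis by blast
    next
      case False
      have "card (S - Q) = 2" using Q finS by (simp add: card_Diff_subset)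
      then have "card (S - Q - {v}) = 1" using False S(2) finS by simp
      moreover have "Q \<subseteq> A - insert v N" using QA nb False Q(1) by auto
      moreover have "S - Q - {v} \<subseteq> ?Z" using QA nb False S(1) by auto
      ultimately have "(Q, S - Q - {v}) \<in> ?X2" using Q(3) by simp
      moreover have "S = ?f (Q, S - Q - {v})" using False Q(1) S(2) by auto
      ultimately show ?thesis by blast
    qed
  qed
  then have "card {S \<in> copies V E. {v} \<subseteq> S \<and> clean W {v} S} \<le> card (?f ` ?X1 \<union> ?f ` ?X2)"
    by (rule card_mono[rotated]) (use fin in blast)
  also have "\<dots> \<le> card ?X1 + card ?X2"
    using card_Un_le[of "?f ` ?X1" "?f ` ?X2"] card_image_le[OF fin(1), of ?f]
      card_image_le[OF fin(2), of ?f] by linarith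
  also have "\<dots> = (card (A \<inter> N) choose 3) * (card ?Z choose 2) + (card (A - insert v N) choose 4) * card ?Z"
    by (simp only: card_cartesian_product n_subsets finite_Diff finite_Int assms(1) finA
        simp_thms choose_one)
  finally show ?thesis .
qed

lemma card_wrong_pairs_insert:
  fixes v :: 'a
  assumes "finite V" "E \<subseteq> pairs V" "A \<subseteq> V"
  defines "N \<equiv> {x. {v, x} \<in> E}"
  shows "card {f \<in> sym_diff E (pairs (insert v A)). v \<in> f} = card (A - insert v N) + card (N - A)"
proof -
  have vN: "v \<notin> N" and NV: "N \<subseteq> V" using assms(2) by (auto simp: N_def)
  have "sym_diff E (pairs (insert v A)) \<subseteq> pairs (insert v V)"
    using assms(2,3) pairs_mono[of V "insert v V"] pairs_mono[of "insert v A" "insert v V"] by blast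
  from card_edges_at[OF this, of v]
  have "card {f \<in> sym_diff E (pairs (insert v A)). v \<in> f} =
      card {x. {v, x} \<in> sym_diff E (pairs (insert v A))}" .
  also have "{x. {v, x} \<in> sym_diff E (pairs (insert v A))} = (A - insert v N) \<union> (N - A)"
    using vN by (auto simp: N_def)
  also have "card \<dots> = card (A - insert v N) + card (N - A)"
    using assms(1,3) NV by (intro card_Un_disjoint) (auto intro: finite_subset)
  finally show ?thesis .
qed

lemma card_wrong_pairs_remove:
  assumes "E \<subseteq> pairs V" "A \<subseteq> V"
  shows "card {f \<in> sym_diff E (pairs (A - {v})). v \<in> f} = card {x. {v, x} \<in> E}"
proof -
  have "sym_diff E (pairs (A - {v})) \<subseteq> pairs V"
    using assms pairs_mono[of "A - {v}" V] by blast
  from card_edges_at[OF this, of v]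
  show ?thesis by simp
qed


section \<open>Linear stability near the extremal graphs\<close>

lemma choose_ge:
  assumes "k \<le> m + 1"
  shows "(real m + 1 - real k) ^ k / fact k \<le> real (m choose k)"
proof -
  have "(real m + 1 - real k) ^ k = (\<Prod>i=0..<k. real m + 1 - real k)" by simp
  also have "\<dots> \<le> (\<Prod>i=0..<k. real m - real i)"
    using assms by (intro prod_mono) auto
  also have "\<dots> / fact k = real (m choose k)"
    by (simp add: binomial_gbinomial gbinomial_prod_rev)
  finally show ?thesis by (simp add: divide_right_mono)
qed

lemma choose_ge_power:
  assumes "0 \<le> c" "c \<le> real m + 1 - real k"
  shows "c ^ k / fact k \<le> real (m choose k)"
proof -
  have "c ^ k / fact k \<le> (real m + 1 - real k) ^ k / fact k"
    using assms by (intro divide_right_mono power_mono) auto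
  also have "\<dots> \<le> real (m choose k)" using assms by (intro choose_ge) linarith
  finally show ?thesis .
qed

text \<open>
  The left side bounds the copies at a vertex with \<open>p n\<close> neighbours and \<open>q n\<close> non-neighbours in \<open>A\<close>,
  and \<open>w n\<close> neighbours and \<open>r n\<close> non-neighbours outside \<open>A\<close>.  By convexity it is at most the value
  for \<open>w = 0\<close> and \<open>p = 0\<close> or \<open>q = 0\<close>, which is \<open>2/729\<close> in both cases when \<open>A\<close> has exactly
  two thirds of the vertices.  The last two assumptions exclude both of these cases: either \<open>w\<close> is at least
  \<open>d = 1 / (2 * 10^4)\<close>, which bounds \<open>r\<close> away from \<open>1/3\<close>, or both \<open>p\<close> and \<open>q\<close> are, which bounds them away from \<open>2/3\<close>.
\<close>

lemma vertex_poly_le: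
  fixes p q r w :: real
  assumes nonneg: "0 \<le> p" "0 \<le> q" "0 \<le> r" "0 \<le> w"
    and "p + q \<le> 2 / 3 + 1 / 10 ^ 6" "r + w \<le> 1 / 3 + 1 / 10 ^ 6"
    and "1 / 10 ^ 4 \<le> p + w" "1 / 10 ^ 4 \<le> q + w"
  shows "p ^ 3 * r\<^sup>2 / 12 + q ^ 4 * r / 24 \<le> 2 / 729 - 1 / (600 * 10 ^ 4)"
proof -
  define a z d :: real where "a = 2 / 3 + 1 / 10 ^ 6" and "z = 1 / 3 + 1 / 10 ^ 6"
    and "d = 1 / (2 * 10 ^ 4)"
  note defs = a_def z_def d_def
  have az: "a / 24 \<le> z / 12" by (simp add: defs)
  have main: "p ^ 3 * r\<^sup>2 / 12 + q ^ 4 * r / 24 \<le> s * (b * a\<^sup>2) * (z / 12)"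
    if b: "p \<le> b" "q \<le> b" "b \<le> a" and s: "r \<le> s" "s \<le> z" for b s
  proof -
    have b0: "0 \<le> b" and s0: "0 \<le> s" using b s nonneg by auto
    have "p ^ 3 = p * (p * p)" by (simp add: power3_eq_cube)
    also have "\<dots> \<le> p * (b * a)" using b nonneg by (intro mult_mono order_refl) auto
    finally have p: "p ^ 3 \<le> p * (b * a)" .
    have "q ^ 4 = q * (q * q * q)" by (simp add: power4_eq_xxxx mult_ac)
    also have "\<dots> \<le> q * (b * a * a)" using b nonneg by (intro mult_mono order_refl) auto
    finally have q: "q ^ 4 \<le> q * (b * a * a)" .
    have "p ^ 3 * r\<^sup>2 / 12 + q ^ 4 * r / 24 = r * (p ^ 3 * (r / 12) + q ^ 4 * (1 / 24))"
      by (simp add: power2_eq_square field_simps)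
    also have "\<dots> \<le> s * (p * (b * a) * (z / 12) + q * (b * a * a) * (1 / 24))"
      using p q s nonneg b0 s0 by (intro mult_mono add_mono) (auto simp: defs)
    also have "\<dots> = s * (b * a) * (p * (z / 12) + q * (a / 24))" by (simp add: algebra_simps)
    also have "\<dots> \<le> s * (b * a) * (p * (z / 12) + q * (z / 12))"
      using az nonneg b0 s0 by (intro mult_left_mono add_left_mono mult_nonneg_nonneg) (auto simp: defs)
    also have "\<dots> = s * (b * a) * (z / 12) * (p + q)" by (simp add: algebra_simps)
    also have "\<dots> \<le> s * (b * a) * (z / 12) * a"
      using assms(5) b0 s0 by (intro mult_left_mono mult_nonneg_nonneg) (auto simp: defs)
    finally show ?thesis by (simp add: power2_eq_square mult_ac)
  qed
  show ?thesis
  proof (cases "d \<le> w")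
    case True
    have "p ^ 3 * r\<^sup>2 / 12 + q ^ 4 * r / 24 \<le> (z - d) * (a * a\<^sup>2) * (z / 12)"
      using True assms by (intro main) (auto simp: defs)
    also have "\<dots> \<le> 2 / 729 - 1 / (600 * 10 ^ 4)" by (simp add: defs power2_eq_square)
    finally show ?thesis .
  next
    case False
    have "p ^ 3 * r\<^sup>2 / 12 + q ^ 4 * r / 24 \<le> z * ((a - d) * a\<^sup>2) * (z / 12)"
      using False assms by (intro main) (auto simp: defs)
    also have "\<dots> \<le> 2 / 729 - 1 / (600 * 10 ^ 4)" by (simp add: defs power2_eq_square)
    finally show ?thesis .
  qed
qed

text \<open>
  A set whose status differs in \<open>E\<close> and \<open>F\<close> contains a pair on which they differ.
\<close>

lemma card_copies_near:
  assumes "finite V" "E \<subseteq> pairs V" "F \<subseteq> pairs V"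
  shows "card (copies V E) \<le> card (copies V F) + card (sym_diff E F) * card V ^ 4"
proof -
  let ?B = "\<lambda>f. {S. f \<subseteq> S \<and> S \<subseteq> V \<and> card S = 6}"
  have fin: "finite (sym_diff E F)"
    using assms by (meson finite_Diff finite_UnI finite_pairs finite_subset)
  have finB: "finite (?B f)" for f using assms(1) by (auto intro: finite_subset[of _ "Pow V"])
  have "copies V E \<subseteq> copies V F \<union> (\<Union>f\<in>sym_diff E F. ?B f)"
  proof
    fix S assume S: "S \<in> copies V E"
    show "S \<in> copies V F \<union> (\<Union>f\<in>sym_diff E F. ?B f)"
    proof (cases "E \<inter> pairs S = F \<inter> pairs S")
      case True
      then show ?thesis using S copy_cong[OF True] by (auto simp: copies_def)
    next
      case False
      then obtain f where "f \<in> sym_diff E F" "f \<in> pairs S" by blast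
      then show ?thesis using S by (auto simp: copies_def copy_def pairs_def)
    qed
  qed
  then have "card (copies V E) \<le> card (copies V F \<union> (\<Union>f\<in>sym_diff E F. ?B f))"
    by (rule card_mono[rotated])
      (intro finite_UnI finite_UN_I finite_copies assms(1) fin finB)
  also have "\<dots> \<le> card (copies V F) + card (\<Union>f\<in>sym_diff E F. ?B f)" by (rule card_Un_le)
  also have "card (\<Union>f\<in>sym_diff E F. ?B f) \<le> (\<Sum>f\<in>sym_diff E F. card (?B f))"
    by (rule card_UN_le[OF fin])
  also have "\<dots> \<le> (\<Sum>f\<in>sym_diff E F. card V ^ 4)"
  proof (rule sum_mono)
    fix f assume "f \<in> sym_diff E F"
    then have f: "card f = 2" "finite f"
      using assms by (auto simp: pairs_def intro: finite_subset)
    show "card (?B f) \<le> card V ^ 4" using card_supersets_le[OF assms(1) f(2), of 6] f(1) by simp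
  qed
  finally show ?thesis by simp
qed

text \<open>
  The number of copies in the clique on \<open>A\<close> is at most \<open>n^6 / 48\<close> times \<open>x^4 (1 - x)^2\<close> for
  \<open>|A| = x n\<close>, and by \<open>clique_poly_le\<close> a deviation \<open>t\<close> of \<open>x\<close> from \<open>2/3\<close> lowers this by at
  least \<open>(4/81) t^2\<close>, whence
  \<open>972 = 48 * 81 / 4\<close>.
\<close>

lemma clique_size_near:
  assumes "finite V" "A \<subseteq> V" "0 < card V" "0 \<le> t"
    and "real (card V) ^ 6 / 2187 - t\<^sup>2 / 972 * real (card V) ^ 6 \<le> real (card (copies V (pairs A)))"
  shows "\<bar>real (card A) - 2 / 3 * real (card V)\<bar> \<le> t * real (card V)"
proof -
  define n where "n = real (card V)"
  define x where "x = real (card A) / n"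
  have n: "0 < n" using assms(3) by (simp add: n_def)
  have a: "real (card A) = n * x" using n by (simp add: x_def)
  have le: "card A \<le> card V" using assms(1,2) by (rule card_mono)
  then have x: "0 \<le> x" "x \<le> 1" using n by (auto simp: x_def n_def)
  have "card (V - A) = card V - card A"
    using assms(1,2) by (simp add: card_Diff_subset finite_subset)
  then have z: "real (card (V - A)) = n * (1 - x)"
    using le a by (simp add: of_nat_diff n_def algebra_simps)
  have "n ^ 6 / 2187 - t\<^sup>2 / 972 * n ^ 6 \<le> real (card A choose 4) * real (card (V - A) choose 2)"
    using assms(5) by (simp add: card_copies_pairs[OF assms(1,2)] n_def)
  also have "\<dots> \<le> (n * x) ^ 4 / 24 * ((n * (1 - x))\<^sup>2 / 2)"
    using choose_le_pow_div_fact[of "card A" 4] choose_le_pow_div_fact[of "card (V - A)" 2]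
    unfolding a z by (intro mult_mono) (auto simp: fact_numeral)
  also have "\<dots> = n ^ 6 / 48 * (x ^ 4 * (1 - x)\<^sup>2)"
    using power_add[of n 4 2] by (simp add: power_mult_distrib)
  also have "\<dots> \<le> n ^ 6 / 48 * (16 / 729 - 4 / 81 * (x - 2 / 3)\<^sup>2)"
    using clique_poly_le[OF x] n by (intro mult_left_mono) auto
  also have "\<dots> = n ^ 6 / 2187 - (x - 2 / 3)\<^sup>2 / 972 * n ^ 6" by (simp add: algebra_simps)
  finally have "(x - 2 / 3)\<^sup>2 \<le> t\<^sup>2" using n by simp
  then have "\<bar>x - 2 / 3\<bar> \<le> t" using assms(4) by (simp add: abs_le_square_iff[symmetric])
  then have "n * \<bar>x - 2 / 3\<bar> \<le> n * t" using n by (intro mult_left_mono) auto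
  moreover have "n * \<bar>x - 2 / 3\<bar> = \<bar>n * (x - 2 / 3)\<bar>" using n by (simp add: abs_mult)
  ultimately show ?thesis unfolding n_def[symmetric] a by (simp add: algebra_simps)
qed

lemma correct_clique_dist:
  assumes "finite V" "A \<subseteq> V" "E \<subseteq> pairs V" "clique_dist V E = card (sym_diff E (pairs A))"
    and "U \<subseteq> sym_diff E (pairs A)" "U \<noteq> {}"
  shows "sym_diff E U \<subseteq> pairs V" "clique_dist V (sym_diff E U) < clique_dist V E"
    and "sym_diff E (sym_diff E U) = U"
proof -
  have sub: "sym_diff E (pairs A) \<subseteq> pairs V" using assms(2,3) pairs_mono by blast
  then show "sym_diff E U \<subseteq> pairs V" using assms(3,5) by blast
  show "sym_diff E (sym_diff E U) = U" by blast
  have "clique_dist V (sym_diff E U) \<le> card (sym_diff (sym_diff E U) (pairs A))"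
    by (rule clique_dist_le[OF assms(1,2)])
  also have "sym_diff (sym_diff E U) (pairs A) = sym_diff E (pairs A) - U"
    using assms(5) by blast
  also have "card \<dots> < card (sym_diff E (pairs A))"
    using assms(5,6) finite_subset[OF sub finite_pairs[OF assms(1)]]
    by (intro psubset_card_mono) auto
  finally show "clique_dist V (sym_diff E U) < clique_dist V E" unfolding assms(4) .
qed

text \<open>
  Attached to \<open>A\<close> in the right way, \<open>v\<close> is in about \<open>2/729 n^5\<close> copies, on whichever side of \<open>A\<close> it is;
  the error in the size of \<open>A\<close> and the rounding cost at most \<open>n^5 / (1500 * 10^4)\<close>.  Before the
  correction \<open>v\<close> falls short by \<open>n^5 / (600 * 10^4)\<close>, up to the few sets with further wrong pairs.
\<close>

lemma correct_vertex_gain: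
  assumes "finite V" "A \<subseteq> V" "E \<subseteq> pairs V" "v \<in> V"
    and dist: "clique_dist V E = card (sym_diff E (pairs A))"
  defines "n \<equiv> real (card V)" and "W \<equiv> sym_diff E (pairs A)"
  assumes n: "10 ^ 23 \<le> n" and small: "real (card W) \<le> n\<^sup>2 / (2 * 10 ^ 15)"
    and size: "\<bar>real (card A) - 2 / 3 * n\<bar> \<le> n / 10 ^ 6"
    and bad: "n / 10 ^ 4 < real (card {f \<in> W. v \<in> f})"
  shows "real (card (copies V E)) + 5 / 10 ^ 8 * n ^ 5 \<le>
    real (card (copies V (sym_diff E {f \<in> W. {v} \<subseteq> f})))"
proof -
  define N where "N = {x. {v, x} \<in> E}"
  have n0: "0 < n" using n by (rule less_le_trans[rotated]) simp
  have NV: "N \<subseteq> V" and vN: "v \<notin> N" using assms(3) by (auto simp: N_def)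
  have Wsub: "W \<subseteq> pairs V" unfolding W_def using assms(2,3) pairs_mono by blast
  have finW: "finite W" using Wsub assms(1) by (meson finite_pairs finite_subset)
  have fin: "finite S" if "S \<subseteq> V" for S using that assms(1) by (rule finite_subset)
  (* by minimality of the distance, moving v to the other side of A leaves it in many wrong pairs *)
  have both: "n / 10 ^ 4 < real (card {f \<in> sym_diff E (pairs B). v \<in> f})"
    if B: "B - {v} = A - {v}" "B \<subseteq> V" for B
  proof -
    let ?W = "sym_diff E (pairs B)"
    have WB: "?W \<subseteq> pairs V" using assms(3) B(2) pairs_mono by blast
    then have finB: "finite ?W" using assms(1) by (meson finite_pairs finite_subset)
    have "{f \<in> ?W. v \<notin> f} = {f \<in> W. v \<notin> f}"
    proof -
      have "f \<subseteq> B \<longleftrightarrow> f \<subseteq> A" if "v \<notin> f" for f using B(1) that by blast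
      then show ?thesis unfolding W_def pairs_def by blast
    qed
    moreover have "card W \<le> card ?W"
      using clique_dist_le[OF assms(1) B(2), of E] dist by (simp add: W_def)
    ultimately have "card {f \<in> W. v \<in> f} \<le> card {f \<in> ?W. v \<in> f}"
      using card_split[OF finW, of v] card_split[OF finB, of v] by simp
    then show ?thesis using bad by linarith
  qed
  define p q r w where "p = card (A \<inter> N)" and "q = card (A - insert v N)"
    and "r = card (V - A - insert v N)" and "w = card (N - A)"
  have wrong_in: "n / 10 ^ 4 < real q + real w"
    using both[of "insert v A"] assms(2,4) card_wrong_pairs_insert[OF assms(1,3,2), of v]
    by (simp add: q_def w_def N_def)
  have "card N = p + w"
    unfolding p_def w_def using card_Int_Diff[of N A] fin[OF NV] by (simp add: Int_commute)
  then have wrong_out: "n / 10 ^ 4 < real p + real w"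
    using both[of "A - {v}"] assms(2) card_wrong_pairs_remove[OF assms(3,2), of v]
    by (auto simp: N_def)
  have "p + q \<le> card A"
  proof -
    have "p + q = card ((A \<inter> N) \<union> (A - insert v N))"
      unfolding p_def q_def using fin assms(2) NV by (subst card_Un_disjoint) (auto intro: fin)
    also have "\<dots> \<le> card A" using assms(2) fin by (intro card_mono) auto
    finally show ?thesis .
  qed
  moreover have "r + w \<le> card (V - A)"
  proof -
    have "r + w = card ((V - A - insert v N) \<union> (N - A))"
      unfolding r_def w_def using assms(1) fin NV by (subst card_Un_disjoint) (auto intro: fin)
    also have "\<dots> \<le> card (V - A)" using assms(1) NV by (intro card_mono) auto
    finally show ?thesis .
  qed
  moreover have cardZ: "real (card (V - A)) = n - real (card A)"
    using assms(1,2) fin by (simp add: n_def card_Diff_subset of_nat_diff card_mono)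
  moreover have "real (p + q) \<le> real (card A)" "real (r + w) \<le> real (card (V - A))"
    using calculation(1,2) by (simp_all only: of_nat_le_iff)
  ultimately have pqrw: "real p + real q \<le> (2 / 3 + 1 / 10 ^ 6) * n"
      "real r + real w \<le> (1 / 3 + 1 / 10 ^ 6) * n"
    using abs_le_D1[OF size] abs_le_D2[OF size] by (simp_all add: algebra_simps)
  have "real (card {S \<in> copies V E. {v} \<subseteq> S \<and> clean W {v} S}) \<le>
      real (p choose 3) * real (r choose 2) + real (q choose 4) * real r"
    using of_nat_mono[OF card_clean_copies_vertex[OF assms(1,2) refl, of E v], where 'a = real]
    by (simp add: W_def p_def q_def r_def N_def)
  also have "\<dots> \<le> real p ^ 3 / 6 * (real r ^ 2 / 2) + real q ^ 4 / 24 * real r"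
    using choose_le_pow_div_fact[of p 3] choose_le_pow_div_fact[of r 2] choose_le_pow_div_fact[of q 4]
    by (intro add_mono mult_mono) (auto simp: fact_numeral)
  also have "\<dots> = n ^ 5 * ((real p / n) ^ 3 * (real r / n)\<^sup>2 / 12 + (real q / n) ^ 4 * (real r / n) / 24)"
    using n0 by (simp add: field_simps power2_eq_square power3_eq_cube power4_eq_xxxx eval_nat_numeral)
  also have "\<dots> \<le> n ^ 5 * (2 / 729 - 1 / (600 * 10 ^ 4))"
  proof (intro mult_left_mono vertex_poly_le)
    show "real p / n + real q / n \<le> 2 / 3 + 1 / 10 ^ 6" "real r / n + real w / n \<le> 1 / 3 + 1 / 10 ^ 6"
      "1 / 10 ^ 4 \<le> real p / n + real w / n" "1 / 10 ^ 4 \<le> real q / n + real w / n"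
      using pqrw wrong_in wrong_out n0 by (simp_all add: field_simps)
  qed (use n0 in auto)
  finally have clean: "real (card {S \<in> copies V E. {v} \<subseteq> S \<and> clean W {v} S}) \<le>
      n ^ 5 * (2 / 729 - 1 / (600 * 10 ^ 4))" .
  have attached: "n ^ 5 * (2 / 729 - 1 / (1500 * 10 ^ 4)) \<le> real (card {S \<in> copies V (pairs A). {v} \<subseteq> S})"
  proof -
    define a z where "a = (2 / 3 - 2 / 10 ^ 6) * n" and "z = (1 / 3 - 2 / 10 ^ 6) * n"
    have az: "0 \<le> a" "a + 3 \<le> real (card A)" "0 \<le> z" "z + 1 \<le> real (card (V - A))"
      using abs_le_D1[OF size] abs_le_D2[OF size] n n0 cardZ
      by (simp_all add: a_def z_def algebra_simps)
    show ?thesis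
    proof (cases "v \<in> A")
      case True
      have "card {S \<in> copies V (pairs A). {v} \<subseteq> S} =
          (card (A - {v}) choose 3) * (card (V - A - {v}) choose 2)"
        by (rule card_copies_pairs_at) (use assms(1,2,4) True in auto)
      moreover have "V - A - {v} = V - A" using True by auto
      moreover have "card (A - {v}) = card A - 1" using True by simp
      moreover have "a ^ 3 / 6 \<le> real (card A - 1 choose 3)"
        using choose_ge_power[of a "card A - 1" 3] az by (simp add: fact_numeral)
      moreover have "z\<^sup>2 / 2 \<le> real (card (V - A) choose 2)"
        using choose_ge_power[of z "card (V - A)" 2] az by (simp add: fact_numeral)
      ultimately have "a ^ 3 / 6 * (z\<^sup>2 / 2) \<le> real (card {S \<in> copies V (pairs A). {v} \<subseteq> S})"
        using az(1) by (simp only: of_nat_mult) (intro mult_mono; simp)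
      moreover have "a ^ 3 / 6 * (z\<^sup>2 / 2) = n ^ 5 * ((2 / 3 - 2 / 10 ^ 6) ^ 3 * (1 / 3 - 2 / 10 ^ 6)\<^sup>2 / 12)"
        using power_add[of n 3 2] unfolding a_def z_def power_mult_distrib by simp
      moreover have "n ^ 5 * (2 / 729 - 1 / (1500 * 10 ^ 4)) \<le>
          n ^ 5 * ((2 / 3 - 2 / 10 ^ 6) ^ 3 * (1 / 3 - 2 / 10 ^ 6)\<^sup>2 / 12)"
        using n0 by (intro mult_left_mono) (simp_all add: power2_eq_square power3_eq_cube)
      ultimately show ?thesis by linarith
    next
      case False
      then have "{v} - A = {v}" by auto
      then have "card {S \<in> copies V (pairs A). {v} \<subseteq> S} =
          (card (A - {v}) choose 4) * (card (V - A - {v}) choose 1)"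
        by (intro card_copies_pairs_at) (use assms(1,2,4) False in auto)
      moreover have "A - {v} = A" using False by auto
      moreover have "card (V - A - {v}) = card (V - A) - 1" using False assms(4) by simp
      moreover have "a ^ 4 / 24 \<le> real (card A choose 4)"
        using choose_ge_power[of a "card A" 4] az by (simp add: fact_numeral)
      moreover have "z \<le> real (card (V - A) - 1 choose 1)" using az by simp
      ultimately have "a ^ 4 / 24 * z \<le> real (card {S \<in> copies V (pairs A). {v} \<subseteq> S})"
        using az by (simp only: of_nat_mult) (intro mult_mono; simp)
      moreover have "a ^ 4 / 24 * z = n ^ 5 * ((2 / 3 - 2 / 10 ^ 6) ^ 4 * (1 / 3 - 2 / 10 ^ 6) / 24)"
        using power_add[of n 4 1] unfolding a_def z_def power_mult_distrib by simp
      moreover have "n ^ 5 * (2 / 729 - 1 / (1500 * 10 ^ 4)) \<le>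
          n ^ 5 * ((2 / 3 - 2 / 10 ^ 6) ^ 4 * (1 / 3 - 2 / 10 ^ 6) / 24)"
        using n0 by (intro mult_left_mono) (simp_all add: power4_eq_xxxx)
      ultimately show ?thesis by linarith
    qed
  qed
  have "real (card {S. {v} \<subseteq> S \<and> S \<subseteq> V \<and> card S = 6 \<and> \<not> clean W {v} S}) \<le> real (card W) * n ^ 3"
    using of_nat_mono[OF card_unclean_vertex_le[OF assms(1) Wsub, of v], where 'a = real]
    by (simp add: n_def)
  also have "\<dots> \<le> n\<^sup>2 / (2 * 10 ^ 15) * n ^ 3"
    using small n0 by (intro mult_right_mono) auto
  also have "\<dots> = n ^ 5 / (2 * 10 ^ 15)" by (simp add: power_add[symmetric])
  finally have unclean: "real (card {S. {v} \<subseteq> S \<and> S \<subseteq> V \<and> card S = 6 \<and> \<not> clean W {v} S}) \<le>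
      n ^ 5 / (2 * 10 ^ 15)" .
  have "real (card (copies V E)) + real (card {S \<in> copies V (pairs A). {v} \<subseteq> S}) \<le>
      real (card (copies V (sym_diff E {f \<in> W. {v} \<subseteq> f})))
      + real (card {S \<in> copies V E. {v} \<subseteq> S \<and> clean W {v} S})
      + 2 * real (card {S. {v} \<subseteq> S \<and> S \<subseteq> V \<and> card S = 6 \<and> \<not> clean W {v} S})"
    using of_nat_mono[OF card_copies_correct[OF assms(1) W_def[THEN meta_eq_to_obj_eq] refl, of "{v}"],
        where 'a = real] by simp
  moreover have "5 / 10 ^ 8 * n ^ 5 \<le> n ^ 5 * (2 / 729 - 1 / (1500 * 10 ^ 4))
      - n ^ 5 * (2 / 729 - 1 / (600 * 10 ^ 4)) - 2 * (n ^ 5 / (2 * 10 ^ 15))"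
    using zero_le_power[of n 5] n0 by (simp add: algebra_simps)
  moreover have "a + b \<le> e" if "a + x \<le> e + c + 2 * u" "b \<le> l - h - 2 * d" "c \<le> h" "l \<le> x" "u \<le> d"
    for a b c d e h l u x :: real using that by linarith
  ultimately show ?thesis using clean attached unclean by blast
qed

text \<open>
  Few of the sets that contain \<open>x\<close> and \<open>y\<close> contain another wrong pair, since the wrong pairs are few
  and have small degrees.  So before the correction almost no set that contains \<open>x\<close> and \<open>y\<close> is a copy,
  and afterwards a positive fraction of them are.
\<close>

lemma correct_pair_gain:
  assumes "finite V" "A \<subseteq> V" "E \<subseteq> pairs V"
  defines "n \<equiv> real (card V)" and "W \<equiv> sym_diff E (pairs A)"
  assumes n: "10 ^ 23 \<le> n" and small: "real (card W) \<le> n\<^sup>2 / (2 * 10 ^ 15)"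
    and size: "\<bar>real (card A) - 2 / 3 * n\<bar> \<le> n / 10 ^ 6"
    and good: "\<And>v. real (card {f \<in> W. v \<in> f}) \<le> n / 10 ^ 4"
    and e: "{x, y} \<in> W"
  shows "real (card (copies V E)) + 5 / 10 ^ 8 * n ^ 4 \<le>
    real (card (copies V (sym_diff E {f \<in> W. {x, y} \<subseteq> f})))"
proof -
  have n0: "0 < n" using n by (rule less_le_trans[rotated]) simp
  have Wsub: "W \<subseteq> pairs V" unfolding W_def using assms(2,3) pairs_mono by blast
  have xy: "x \<in> V" "y \<in> V" "x \<noteq> y" using e Wsub by auto
  have finA: "finite A" using assms(1,2) finite_subset by blast
  have "{S \<in> copies V E. {x, y} \<subseteq> S \<and> clean W {x, y} S} = {}"
    using no_clean_copy_at_wrong_pair[OF _ e[unfolded W_def] xy(3)] unfolding W_def copies_def by blast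
  then have clean: "card {S \<in> copies V E. {x, y} \<subseteq> S \<and> clean W {x, y} S} = 0"
    by (simp only: card.empty)
  have "real (card {S. {x, y} \<subseteq> S \<and> S \<subseteq> V \<and> card S = 6 \<and> \<not> clean W {x, y} S}) \<le>
      (real (card {f \<in> W. x \<in> f}) + real (card {f \<in> W. y \<in> f})) * n ^ 3 + real (card W) * n ^ 2"
    using of_nat_mono[OF card_unclean_pair_le[OF assms(1) Wsub xy(3)], where 'a = real]
    by (simp add: n_def)
  also have "\<dots> \<le> (n / 10 ^ 4 + n / 10 ^ 4) * n ^ 3 + n\<^sup>2 / (2 * 10 ^ 15) * n ^ 2"
    using good[of x] good[of y] small n0 by (intro add_mono mult_right_mono) auto
  also have "\<dots> = (2 / 10 ^ 4 + 1 / (2 * 10 ^ 15)) * n ^ 4"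
    by (simp add: field_simps power4_eq_xxxx power3_eq_cube power2_eq_square)
  finally have unclean: "real (card {S. {x, y} \<subseteq> S \<and> S \<subseteq> V \<and> card S = 6 \<and> \<not> clean W {x, y} S}) \<le>
      (2 / 10 ^ 4 + 1 / (2 * 10 ^ 15)) * n ^ 4" .
  have attached: "n ^ 4 / 384 \<le> real (card {S \<in> copies V (pairs A). {x, y} \<subseteq> S})"
  proof -
    let ?k = "card ({x, y} - A)"
    define P R where "P = card (A - {x, y})" and "R = card (V - A - {x, y})"
    have k: "card ({x, y} \<inter> A) + ?k = 2"
      using card_Int_Diff[of "{x, y}" A] xy(3) by simp
    have "real (card A) - 2 \<le> real P"
    proof -
      have "card A \<le> card (A - {x, y}) + card {x, y}"
        using finA by (metis card_Diff_subset_Int card_Un_le Un_Diff_cancel2 Un_upper1 card_mono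
            finite.emptyI finite_UnI finite_insert le_trans)
      then show ?thesis using xy(3) by (simp add: P_def)
    qed
    moreover have "real (card (V - A)) - 2 \<le> real R"
    proof -
      have "card (V - A) \<le> card (V - A - {x, y}) + card {x, y}"
        using assms(1) by (metis card_Diff_subset_Int card_Un_le Un_Diff_cancel2 Un_upper1 card_mono
            finite.emptyI finite_UnI finite_insert finite_Diff le_trans)
      then show ?thesis using xy(3) by (simp add: R_def)
    qed
    moreover have "real (card (V - A)) = n - real (card A)"
      using assms(1,2) finA by (simp add: n_def card_Diff_subset of_nat_diff card_mono)
    ultimately have PR: "n / 2 + 3 \<le> real P" "n / 4 + 1 \<le> real R"
      using abs_le_D1[OF size] abs_le_D2[OF size] n by simp_all
    have eq: "card {S \<in> copies V (pairs A). {x, y} \<subseteq> S} = (P choose i) * (R choose j)"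
      if "card ({x, y} \<inter> A) + i = 4" "?k + j = 2" for i j
      unfolding P_def R_def using assms(1,2) xy that by (intro card_copies_pairs_at) auto
    have prod: "c * n ^ 4 \<le> real ((P choose i) * (R choose j))"
      if "i \<le> 4" "j \<le> 2" "c * n ^ 4 = ((n / 2) ^ i / fact i) * ((n / 4) ^ j / fact j)" for i j c
    proof -
      have "(n / 2) ^ i / fact i \<le> real (P choose i)" "(n / 4) ^ j / fact j \<le> real (R choose j)"
        using PR n0 that(1,2) by (intro choose_ge_power; simp)+
      then have "((n / 2) ^ i / fact i) * ((n / 4) ^ j / fact j) \<le> real (P choose i) * real (R choose j)"
        using n0 by (intro mult_mono) auto
      then show ?thesis using that(3) by simp
    qed
    have n4: "0 \<le> n ^ 4" by simp
    consider "?k = 0" | "?k = 1" | "?k = 2" using k by linarith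
    then show ?thesis
    proof cases
      case 1
      have "1 / 256 * n ^ 4 \<le> real ((P choose 2) * (R choose 2))"
        by (rule prod) (simp_all add: fact_numeral power4_eq_xxxx power2_eq_square field_simps)
      moreover have "card {S \<in> copies V (pairs A). {x, y} \<subseteq> S} = (P choose 2) * (R choose 2)"
        by (rule eq) (use 1 k in linarith)+
      ultimately show ?thesis using n4 by linarith
    next
      case 2
      have "1 / 192 * n ^ 4 \<le> real ((P choose 3) * (R choose 1))"
        by (rule prod) (simp_all add: fact_numeral power4_eq_xxxx power3_eq_cube field_simps)
      moreover have "card {S \<in> copies V (pairs A). {x, y} \<subseteq> S} = (P choose 3) * (R choose 1)"
        by (rule eq) (use 2 k in linarith)+
      ultimately show ?thesis using n4 by linarith
    next
      case 3
      have "1 / 384 * n ^ 4 \<le> real ((P choose 4) * (R choose 0))"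
        by (rule prod) (simp_all add: fact_numeral power4_eq_xxxx field_simps)
      moreover have "card {S \<in> copies V (pairs A). {x, y} \<subseteq> S} = (P choose 4) * (R choose 0)"
        by (rule eq) (use 3 k in linarith)+
      ultimately show ?thesis using n4 by linarith
    qed
  qed
  have "real (card (copies V E)) + real (card {S \<in> copies V (pairs A). {x, y} \<subseteq> S}) \<le>
      real (card (copies V (sym_diff E {f \<in> W. {x, y} \<subseteq> f})))
      + 2 * real (card {S. {x, y} \<subseteq> S \<and> S \<subseteq> V \<and> card S = 6 \<and> \<not> clean W {x, y} S})"
    using of_nat_mono[OF card_copies_correct[OF assms(1) W_def[THEN meta_eq_to_obj_eq] refl, of "{x, y}"],
        where 'a = real] clean by simp
  moreover have "5 / 10 ^ 8 * n ^ 4 \<le> n ^ 4 / 384 - 2 * ((2 / 10 ^ 4 + 1 / (2 * 10 ^ 15)) * n ^ 4)"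
    using zero_le_power[of n 4] n0 by simp
  ultimately show ?thesis using attached unclean by linarith
qed

text \<open>
  The induction follows the corrections.  They keep the number of copies large, so that the clique of
  a closest extremal graph has about \<open>2 n / 3\<close> vertices at each stage.
\<close>

lemma local_stability:
  assumes "finite V" and "10 ^ 23 \<le> real (card V)" and "E \<subseteq> pairs V"
  defines "n \<equiv> real (card V)"
  assumes max: "\<And>F. F \<subseteq> pairs V \<Longrightarrow> real (card (copies V F)) \<le> M"
    and "n ^ 6 / 2187 - n ^ 6 / (2 * 10 ^ 15) \<le> real (card (copies V E))"
    and "real (clique_dist V E) \<le> n\<^sup>2 / (2 * 10 ^ 15)"
  shows "5 / 10 ^ 8 * n ^ 4 * real (clique_dist V E) \<le> M - real (card (copies V E))"
  using assms(3,6,7)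
proof (induction "clique_dist V E" arbitrary: E rule: less_induct)
  case less
  have n: "10 ^ 23 \<le> n" using assms(2) by (simp add: n_def)
  then have n0: "0 < n" by (rule less_le_trans[rotated]) simp
  obtain A where A: "A \<subseteq> V" "clique_dist V E = card (sym_diff E (pairs A))"
    using clique_distE[OF assms(1)] by blast
  define W where "W = sym_diff E (pairs A)"
  have Wsub: "W \<subseteq> pairs V" unfolding W_def using A(1) less(2) pairs_mono by blast
  have finW: "finite W" using Wsub assms(1) by (meson finite_pairs finite_subset)
  have small: "real (card W) \<le> n\<^sup>2 / (2 * 10 ^ 15)" using less(4) A(2) by (simp add: W_def)
  have size: "\<bar>real (card A) - 2 / 3 * n\<bar> \<le> n / 10 ^ 6"
  proof -
    have "real (card (copies V E)) \<le> real (card (copies V (pairs A))) + real (card W) * n ^ 4"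
      using of_nat_mono[OF card_copies_near[OF assms(1) less(2) pairs_mono[OF A(1)]], where 'a = real]
      by (simp add: n_def W_def)
    moreover have "real (card W) * n ^ 4 \<le> n\<^sup>2 / (2 * 10 ^ 15) * n ^ 4"
      using small by (intro mult_right_mono) auto
    moreover have "n\<^sup>2 / (2 * 10 ^ 15) * n ^ 4 = n ^ 6 / (2 * 10 ^ 15)" by (simp add: power_add[symmetric])
    ultimately have "n ^ 6 / 2187 - 2 * (n ^ 6 / (2 * 10 ^ 15)) \<le> real (card (copies V (pairs A)))"
      using less(3) by linarith
    moreover have "2 * (n ^ 6 / (2 * 10 ^ 15)) \<le> (1 / 10 ^ 6)\<^sup>2 / 972 * n ^ 6"
      using zero_le_power[of n 6] n0 by (simp add: power2_eq_square)
    ultimately have "n ^ 6 / 2187 - (1 / 10 ^ 6)\<^sup>2 / 972 * n ^ 6 \<le> real (card (copies V (pairs A)))"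
      by linarith
    then show ?thesis
      using clique_size_near[OF assms(1) A(1), of "1 / 10 ^ 6"] n0 by (simp add: n_def)
  qed
  show ?case
  proof (cases "W = {}")
    case True
    then have "clique_dist V E = 0" unfolding A(2) W_def[symmetric] by simp
    then show ?thesis using max[OF less(2)] by simp
  next
    case False
    (* U consists of the wrong pairs at a bad vertex if there is one, and of a single wrong pair otherwise *)
    obtain U where U: "U \<subseteq> W" "U \<noteq> {}" and
      gain: "real (card (copies V E)) + 5 / 10 ^ 8 * n ^ 4 * real (card U) \<le>
        real (card (copies V (sym_diff E U)))"
    proof (cases "\<exists>v. n / 10 ^ 4 < real (card {f \<in> W. v \<in> f})")
      case True
      then obtain v where v: "n / 10 ^ 4 < real (card {f \<in> W. v \<in> f})" by blast
      let ?U = "{f \<in> W. {v} \<subseteq> f}"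
      have ne: "?U \<noteq> {}"
      proof
        assume "?U = {}"
        then have "{f \<in> W. v \<in> f} = {}" by auto
        then have "real (card {f \<in> W. v \<in> f}) = 0" by (simp only: card.empty of_nat_0)
        then show False using v n0 by simp
      qed
      then have "v \<in> V" using Wsub by (auto simp: pairs_def)
      have "card ?U \<le> card V" using card_edges_at_le[OF Wsub assms(1), of v] by simp
      then have "5 / 10 ^ 8 * n ^ 4 * real (card ?U) \<le> 5 / 10 ^ 8 * n ^ 4 * n"
        using n0 by (intro mult_left_mono) (simp_all add: n_def)
      also have "\<dots> = 5 / 10 ^ 8 * n ^ 5" by (simp add: eval_nat_numeral)
      finally have "real (card (copies V E)) + 5 / 10 ^ 8 * n ^ 4 * real (card ?U) \<le>
          real (card (copies V (sym_diff E ?U)))"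
        using correct_vertex_gain[OF assms(1) A(1) less(2) \<open>v \<in> V\<close> A(2)] n small size v
        unfolding n_def W_def by linarith
      then show thesis using that[of ?U] ne by blast
    next
      case no_bad: False
      obtain f where f: "f \<in> W" using False by blast
      then have "f \<in> pairs V" using Wsub by blast
      then obtain x y where "f = {x, y}" "x \<noteq> y" by (rule pairsE)
      then have xy: "{x, y} \<in> W" "x \<noteq> y" using f by simp_all
      let ?U = "{f \<in> W. {x, y} \<subseteq> f}"
      have U: "?U = {{x, y}}"
      proof (intro equalityI subsetI)
        fix f assume f: "f \<in> ?U"
        then have "f \<in> pairs V" using Wsub by blast
        then obtain a b where "f = {a, b}" by (rule pairsE)
        then show "f \<in> {{x, y}}" using f xy(2) by auto
      qed (use xy in auto)
      have "real (card (copies V E)) + 5 / 10 ^ 8 * n ^ 4 \<le> real (card (copies V (sym_diff E ?U)))"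
        using correct_pair_gain[OF assms(1) A(1) less(2)] n small size no_bad xy(1)
        unfolding n_def W_def by (simp add: not_less)
      then show thesis using that[of ?U] xy unfolding U by simp
    qed
    note E' = correct_clique_dist[OF assms(1) A(1) less(2) A(2) U(1)[unfolded W_def] U(2)]
    have nonneg: "0 \<le> 5 / 10 ^ 8 * n ^ 4 * real (card U)" by simp
    have "5 / 10 ^ 8 * n ^ 4 * real (clique_dist V (sym_diff E U)) \<le>
        M - real (card (copies V (sym_diff E U)))"
      by (rule less(1)[OF E'(2,1)]) (use gain nonneg less(3,4) E'(2) in linarith)+
    moreover have "clique_dist V E \<le> clique_dist V (sym_diff E U) + card U"
      using clique_dist_triangle[OF assms(1) less(2) E'(1)] unfolding E'(3) .
    then have "5 / 10 ^ 8 * n ^ 4 * real (clique_dist V E) \<le>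
        5 / 10 ^ 8 * n ^ 4 * real (clique_dist V (sym_diff E U) + card U)"
      by (intro mult_left_mono) (simp_all only: of_nat_le_iff, simp)
    moreover have "\<dots> = 5 / 10 ^ 8 * n ^ 4 * real (clique_dist V (sym_diff E U)) +
        5 / 10 ^ 8 * n ^ 4 * real (card U)" by (simp add: algebra_simps)
    ultimately show ?thesis using gain by linarith
  qed
qed

section \<open>Nearly extremal graphs are close to extremal ones\<close>

text \<open>
  Going back along the symmetrisation path, one step increases the distance from at most \<open>n^2 / (4 * 10^15)\<close> to at
  most twice this value, where \<open>local_stability\<close> applies and returns the bound \<open>n^2 / (4 * 10^15)\<close>.
\<close>

lemma global_stability:
  assumes "finite V" and "10 ^ 23 \<le> real (card V)" and "E \<subseteq> pairs V"
  defines "n \<equiv> real (card V)"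
  assumes "n ^ 6 / 2187 - n ^ 6 / 10 ^ 23 \<le> real (card (copies V E))"
  shows "real (clique_dist V E) \<le> n\<^sup>2 / (4 * 10 ^ 15)"
  using assms(1,3,5)
proof (induction rule: symmetrisation_induct)
  case (cliques E)
  have n: "10 ^ 23 \<le> n" using assms(2) by (simp add: n_def)
  then have n0: "0 < n" by (rule less_le_trans[rotated]) simp
  then have ne: "V \<noteq> {}" by (auto simp: n_def)
  obtain PP where PP: "partition_on V PP" "E = (\<Union>P\<in>PP. pairs P)"
    using disjoint_cliquesE[OF assms(1) cliques(1,2)] by blast
  have n6: "0 < n ^ 6" using n0 by simp
  show ?case
  proof (rule disjoint_cliques_near_clique[OF assms(1) ne PP(1)], goal_cases)
    case 1
    then have False using cliques(3) n6 unfolding PP(2)[symmetric] n_def[symmetric]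
      by (simp add: left_diff_distrib)
    then show ?thesis ..
  next
    case (2 A)
    then have "n ^ 4 / 16 * real (card (sym_diff E (pairs A))) \<le> 48 * (n ^ 6 / 10 ^ 23)"
      using cliques(3) unfolding PP(2)[symmetric] n_def[symmetric] by linarith
    also have "\<dots> \<le> n ^ 6 / (64 * 10 ^ 15)" using n6 by simp
    also have "\<dots> = n ^ 4 / 16 * (n\<^sup>2 / (4 * 10 ^ 15))" by (simp add: power_add[symmetric])
    finally have "real (card (sym_diff E (pairs A))) \<le> n\<^sup>2 / (4 * 10 ^ 15)"
      by (rule mult_left_le_imp_le) (use n0 in simp)
    then show ?thesis using clique_dist_le[OF assms(1) 2(1), of E] by linarith
  qed
next
  case (step E E')
  have n: "10 ^ 23 \<le> n" using assms(2) by (simp add: n_def)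
  then have n0: "0 < n" by (rule less_le_trans[rotated]) simp
  have le: "real (card (copies V E)) \<le> real (card (copies V E'))" using step(3) by simp
  have "real (clique_dist V E') \<le> n\<^sup>2 / (4 * 10 ^ 15)" using step(5,6) le by linarith
  moreover have "real (clique_dist V E) \<le> real (clique_dist V E') + n"
    using clique_dist_triangle[OF assms(1) step(1,2)] step(4) unfolding n_def by linarith
  moreover have "n \<le> n\<^sup>2 / (4 * 10 ^ 15)"
  proof -
    have "(4 * 10 ^ 15) * n \<le> n * n" using n n0 by (intro mult_right_mono) auto
    then show ?thesis by (simp add: power2_eq_square field_simps)
  qed
  ultimately have small: "real (clique_dist V E) \<le> n\<^sup>2 / (2 * 10 ^ 15)" by simp
  have n6: "0 < n ^ 6" using n0 by simp
  have "n ^ 6 / 2187 - n ^ 6 / (2 * 10 ^ 15) \<le> real (card (copies V E))"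
    using step(6) n6 by simp
  then have "5 / 10 ^ 8 * n ^ 4 * real (clique_dist V E) \<le> n ^ 6 / 2187 - real (card (copies V E))"
    using local_stability[OF assms(1,2) step(1), of "n ^ 6 / 2187"] card_copies_le[OF assms(1)] small
    unfolding n_def by blast
  also have "\<dots> \<le> n ^ 6 / 10 ^ 23" using step(6) by linarith
  also have "\<dots> \<le> 5 / 10 ^ 8 * n ^ 6 / (4 * 10 ^ 15)" using n6 by simp
  also have "\<dots> = 5 / 10 ^ 8 * n ^ 4 * (n\<^sup>2 / (4 * 10 ^ 15))" by (simp add: power_add[symmetric])
  finally show ?case by (rule mult_left_le_imp_le) (use n0 in simp)
qed


section \<open>Densities in large graphs\<close>

lemma blowup_B37:
  fixes V :: "nat \<Rightarrow> 'a set"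
  shows "blowup B37 V = (V 0 \<union> V 1, pairs (V 0))"
proof -
  have "edges (blowup B37 V) = pairs (V 0)"
  proof (rule pairs_eqI[of _ UNIV _ "V 0"])
    show "edges (blowup B37 V) \<subseteq> pairs UNIV" by (auto simp: blowup_def)
    fix x y :: 'a assume "x \<noteq> y"
    then show "{x, y} \<in> edges (blowup B37 V) \<longleftrightarrow> {x, y} \<in> pairs (V 0)"
      by (auto simp: blowup_def B37_def doubleton_eq_iff)
  qed auto
  moreover have "verts (blowup B37 V) = V 0 \<union> V 1"
    by (auto simp: blowup_def B37_def less_2_cases_iff)
  ultimately show ?thesis by (metis prod.collapse)
qed

lemma simple_graph_iff: "simple_graph G \<longleftrightarrow> finite (verts G) \<and> edges G \<subseteq> pairs (verts G)"
  by (simp add: simple_graph_def pairs_def)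

lemma edit_distance_le_clique_dist:
  assumes "simple_graph G"
  shows "edit_distance G B37 \<le> clique_dist (verts G) (edges G)"
proof -
  have fin: "finite (verts G)" using assms by (simp add: simple_graph_iff)
  obtain A where A: "A \<subseteq> verts G"
    and dist: "clique_dist (verts G) (edges G) = card (sym_diff (edges G) (pairs A))"
    using clique_distE[OF fin] by blast
  define H where "H = (verts G, pairs A)"
  define P where "P = (\<lambda>i :: nat. if i = 0 then A else verts G - A)"
  have "blowup_parts B37 P"
    using A fin finite_subset
    by (auto simp: blowup_parts_def P_def disjoint_family_on_def B37_def)
  moreover have "blowup B37 P = H" using A by (auto simp: blowup_B37 P_def H_def)
  ultimately have "H \<in> blowups B37" unfolding blowups_def by blast
  moreover have "isomorphic H H"
    unfolding isomorphic_def isomorphism_def by (intro exI[of _ id]) auto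
  moreover have "simple_graph H" "verts H = verts G"
    using fin pairs_mono[OF A] by (auto simp: simple_graph_iff H_def)
  ultimately show ?thesis
    unfolding edit_distance_def dist by (intro Least_le) (auto simp: H_def)
qed

lemma finite_densities:
  "finite {induced_density F37 G | G :: nat pattern. simple_graph G \<and> card (verts G) = n}"
proof (rule finite_subset)
  show "{induced_density F37 G | G :: nat pattern. simple_graph G \<and> card (verts G) = n}
      \<subseteq> (\<lambda>k. real k / real (n choose 6)) ` {..2 ^ n}"
  proof clarify
    fix G :: "nat pattern" assume G: "simple_graph G"
    have "card (copies (verts G) (edges G)) \<le> card (Pow (verts G))"
      using G by (intro card_mono) (auto simp: simple_graph_iff copies_def)
    then have "card (copies (verts G) (edges G)) \<le> 2 ^ card (verts G)"
      using G by (simp add: card_Pow simple_graph_iff)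
    moreover have "induced_density F37 G =
        real (card (copies (verts G) (edges G))) / real (card (verts G) choose 6)"
      using G by (intro induced_density_F37) (simp add: simple_graph_iff)
    ultimately show "induced_density F37 G \<in>
        (\<lambda>k. real k / real (card (verts G) choose 6)) ` {..2 ^ card (verts G)}" by blast
  qed
qed simp

lemma max_density_ge:
  fixes G :: "nat pattern"
  assumes "simple_graph G"
  shows "induced_density F37 G \<le> max_density F37 (card (verts G))"
  unfolding max_density_def by (rule Max_ge[OF finite_densities]) (use assms in blast)

lemma max_density_attained:
  obtains G :: "nat pattern"
  where "simple_graph G" "card (verts G) = n" "max_density F37 n = induced_density F37 G"
proof -
  have "simple_graph ({0..<n}, {})" "card (verts ({0..<n}, {} :: nat set set)) = n"
    by (simp_all add: simple_graph_def)
  then have "{induced_density F37 G | G :: nat pattern. simple_graph G \<and> card (verts G) = n} \<noteq> {}"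
    by blast
  from Max_in[OF finite_densities this] show thesis
    using that unfolding max_density_def by blast
qed

lemma max_density_le: "max_density F37 n \<le> real n ^ 6 / 2187 / real (n choose 6)"
proof -
  obtain G :: "nat pattern" where G: "simple_graph G" "card (verts G) = n"
    "max_density F37 n = induced_density F37 G" by (rule max_density_attained)
  have "real (card (copies (verts G) (edges G))) \<le> real n ^ 6 / 2187"
    using card_copies_le[of "verts G" "edges G"] G(1,2) by (simp add: simple_graph_iff)
  then have "real (card (copies (verts G) (edges G))) / real (n choose 6) \<le>
      real n ^ 6 / 2187 / real (n choose 6)" by (rule divide_right_mono) simp
  then show ?thesis using G by (simp add: induced_density_F37 simple_graph_iff)
qed

lemma max_density_ge_clique:
  assumes "a \<le> n"
  shows "real (a choose 4) * real (n - a choose 2) / real (n choose 6) \<le> max_density F37 n"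
proof -
  define G :: "nat pattern" where "G = ({0..<n}, pairs {0..<a})"
  have G: "simple_graph G" using assms by (simp add: G_def simple_graph_iff pairs_mono)
  have "card (copies {0..<n} (pairs {0..<a})) = (a choose 4) * (n - a choose 2)"
    using assms by (subst card_copies_pairs) (auto simp: card_Diff_subset)
  then have "induced_density F37 G = real (a choose 4) * real (n - a choose 2) / real (n choose 6)"
    using G by (subst induced_density_F37) (simp_all add: simple_graph_iff G_def)
  moreover have "card (verts G) = n" by (simp add: G_def)
  ultimately show ?thesis using max_density_ge[OF G] by simp
qed

lemma choose_tendsto:
  assumes "(\<lambda>n. real (f n) / real n) \<longlonglongrightarrow> x"
  shows "(\<lambda>n. real (f n choose k) / real n ^ k) \<longlonglongrightarrow> x ^ k / fact k"
proof -
  have "(\<lambda>n. (\<Prod>i=0..<k. real (f n) / real n - real i * (1 / real n)) / fact k)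
      \<longlonglongrightarrow> (\<Prod>i=0..<k. x - real i * 0) / fact k"
    by (intro tendsto_intros assms lim_1_over_n) simp
  moreover have "(\<Prod>i=0..<k. real (f n) / real n - real i * (1 / real n)) / fact k =
      real (f n choose k) / real n ^ k" for n
  proof -
    have "(\<Prod>i=0..<k. real (f n) / real n - real i * (1 / real n)) =
        (\<Prod>i=0..<k. (real (f n) - real i) / real n)"
      by (intro prod.cong) (simp_all add: diff_divide_distrib)
    then show ?thesis
      by (simp add: binomial_gbinomial gbinomial_prod_rev prod_dividef)
  qed
  ultimately show ?thesis by simp
qed

lemma clique_density_tendsto:
  fixes x y :: real
  assumes "(\<lambda>n. real (a n) / real n) \<longlonglongrightarrow> x" "(\<lambda>n. real (z n) / real n) \<longlonglongrightarrow> y" "x + y = 1"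
  shows "(\<lambda>n. real (a n choose 4) * real (z n choose 2) / real (a n + z n choose 6))
    \<longlonglongrightarrow> 15 * (x ^ 4 * y\<^sup>2)"
proof -
  have "(\<lambda>n. real (a n + z n) / real n) \<longlonglongrightarrow> x + y"
    using tendsto_add[OF assms(1,2)] by (simp add: add_divide_distrib)
  then have "(\<lambda>n. real (a n + z n choose 6) / real n ^ 6) \<longlonglongrightarrow> (x + y) ^ 6 / fact 6"
    by (rule choose_tendsto)
  from tendsto_divide[OF tendsto_mult[OF choose_tendsto[OF assms(1), of 4]
        choose_tendsto[OF assms(2), of 2]] this]
  have "(\<lambda>n. (real (a n choose 4) / real n ^ 4) * (real (z n choose 2) / real n ^ 2) /
      (real (a n + z n choose 6) / real n ^ 6))
      \<longlonglongrightarrow> (x ^ 4 / fact 4) * (y ^ 2 / fact 2) / ((x + y) ^ 6 / fact 6)"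
    by (simp add: assms(3))
  also have "(x ^ 4 / fact 4) * (y ^ 2 / fact 2) / ((x + y) ^ 6 / fact 6) = 15 * (x ^ 4 * y\<^sup>2)"
    by (simp add: assms(3) fact_numeral)
  finally have lim: "(\<lambda>n. (real (a n choose 4) / real n ^ 4) * (real (z n choose 2) / real n ^ 2) /
      (real (a n + z n choose 6) / real n ^ 6)) \<longlonglongrightarrow> 15 * (x ^ 4 * y\<^sup>2)" .
  have eq: "eventually (\<lambda>n. (real (a n choose 4) / real n ^ 4) * (real (z n choose 2) / real n ^ 2) /
      (real (a n + z n choose 6) / real n ^ 6) =
      real (a n choose 4) * real (z n choose 2) / real (a n + z n choose 6)) sequentially"
    using eventually_gt_at_top[of 0]
  proof eventually_elim
    case (elim n)
    have "real n ^ 6 = real n ^ 4 * real n ^ 2" by (simp flip: power_add)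
    then show ?case using elim by (simp add: divide_simps)
  qed
  from lim eq show ?thesis by (rule Lim_transform_eventually)
qed

lemma nat_floor_tendsto:
  assumes "0 \<le> x"
  shows "(\<lambda>n. real (nat \<lfloor>x * real n\<rfloor>) / real n) \<longlonglongrightarrow> x"
proof (rule tendsto_sandwich)
  have floor: "x * real n - 1 \<le> real (nat \<lfloor>x * real n\<rfloor>)" "real (nat \<lfloor>x * real n\<rfloor>) \<le> x * real n" for n
  proof -
    have "0 \<le> x * real n" using assms by simp
    then show "x * real n - 1 \<le> real (nat \<lfloor>x * real n\<rfloor>)" "real (nat \<lfloor>x * real n\<rfloor>) \<le> x * real n"
      by linarith+
  qed
  show "eventually (\<lambda>n. x - 1 / real n \<le> real (nat \<lfloor>x * real n\<rfloor>) / real n) sequentially"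
    using eventually_gt_at_top[of 0]
  proof eventually_elim
    case (elim n)
    have "(x * real n - 1) / real n \<le> real (nat \<lfloor>x * real n\<rfloor>) / real n"
      using floor(1) by (rule divide_right_mono) simp
    then show ?case using elim by (simp add: diff_divide_distrib)
  qed
  show "eventually (\<lambda>n. real (nat \<lfloor>x * real n\<rfloor>) / real n \<le> x) sequentially"
    using eventually_gt_at_top[of 0]
  proof eventually_elim
    case (elim n)
    have "real (nat \<lfloor>x * real n\<rfloor>) / real n \<le> x * real n / real n"
      using floor(2) by (rule divide_right_mono) simp
    then show ?case using elim by simp
  qed
  show "(\<lambda>n. x - 1 / real n) \<longlonglongrightarrow> x"
    using tendsto_diff[OF tendsto_const lim_1_over_n, of x] by simp
qed simp

lemma max_density_tendsto: "max_density F37 \<longlonglongrightarrow> 80 / 243"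
proof (rule tendsto_sandwich)
  define a where "a = (\<lambda>n. nat \<lfloor>2 / 3 * real n\<rfloor>)"
  have le: "a n \<le> n" for n unfolding a_def by linarith
  have a: "(\<lambda>n. real (a n) / real n) \<longlonglongrightarrow> 2 / 3"
    unfolding a_def by (rule nat_floor_tendsto) simp
  have "(\<lambda>n. 1 - real (a n) / real n) \<longlonglongrightarrow> 1 - 2 / 3" by (intro tendsto_intros a)
  moreover have "eventually (\<lambda>n. 1 - real (a n) / real n = real (n - a n) / real n) sequentially"
    using eventually_gt_at_top[of 0]
    by eventually_elim (use le in \<open>simp add: of_nat_diff field_simps\<close>)
  ultimately have z: "(\<lambda>n. real (n - a n) / real n) \<longlonglongrightarrow> 1 / 3" by (simp cong: filterlim_cong)
  show "(\<lambda>n. real (a n choose 4) * real (n - a n choose 2) / real (n choose 6)) \<longlonglongrightarrow> 80 / 243"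
    using clique_density_tendsto[OF a z] le by (simp add: power_divide)
  show "eventually (\<lambda>n. real (a n choose 4) * real (n - a n choose 2) / real (n choose 6)
      \<le> max_density F37 n) sequentially"
    using le by (intro always_eventually allI max_density_ge_clique)
  show "eventually (\<lambda>n. max_density F37 n \<le> 1 / 2187 / (real (n choose 6) / real n ^ 6)) sequentially"
    using max_density_le by (intro always_eventually allI) (simp add: field_simps)
  have "(\<lambda>n. real n / real n) \<longlonglongrightarrow> 1"
    by (rule tendsto_eventually) (use eventually_gt_at_top[of 0] in eventually_elim, simp)
  from choose_tendsto[OF this, of 6]
  have "(\<lambda>n. real (n choose 6) / real n ^ 6) \<longlonglongrightarrow> 1 / 720" by (simp add: fact_numeral)
  from tendsto_divide[OF tendsto_const[of "1 / 2187"] this]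
  show "(\<lambda>n. 1 / 2187 / (real (n choose 6) / real n ^ 6)) \<longlonglongrightarrow> 80 / 243" by simp
qed

text \<open>
  With \<open>t = 1 - 6 / n\<close> both binomial coefficients are at least the corresponding powers of \<open>t n\<close>, and
  Bernoulli's inequality bounds \<open>t^6\<close>.
\<close>

lemma clique_count_ge:
  assumes "10 ^ 23 \<le> real n"
  obtains a where "a \<le> n"
    "real n ^ 6 / 2187 - real n ^ 6 / (2 * 10 ^ 23) \<le> real (a choose 4) * real (n - a choose 2)"
proof -
  define a where "a = nat \<lfloor>2 / 3 * real n\<rfloor>"
  define t where "t = 1 - 6 / real n"
  have n0: "0 < real n" using assms by (rule less_le_trans[rotated]) simp
  have le: "a \<le> n" unfolding a_def by linarith
  have a: "2 / 3 * real n - 1 \<le> real a" "real a \<le> 2 / 3 * real n" unfolding a_def by linarith+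
  have t0: "0 \<le> t" using assms n0 by (simp add: t_def field_simps)
  have nt: "real n * t = real n - 6" using n0 by (simp add: t_def field_simps)
  have "(2 / 3 * (real n * t)) ^ 4 / fact 4 \<le> real (a choose 4)"
    using a assms unfolding nt by (intro choose_ge_power) auto
  moreover have "(1 / 3 * (real n * t)) ^ 2 / fact 2 \<le> real (n - a choose 2)"
    using a le assms unfolding nt by (intro choose_ge_power) (auto simp: of_nat_diff)
  ultimately have "((2 / 3 * (real n * t)) ^ 4 / fact 4) * ((1 / 3 * (real n * t)) ^ 2 / fact 2) \<le>
      real (a choose 4) * real (n - a choose 2)"
    by (intro mult_mono) auto
  moreover have "((2 / 3 * (real n * t)) ^ 4 / fact 4) * ((1 / 3 * (real n * t)) ^ 2 / fact 2) =
      real n ^ 6 / 2187 * t ^ 6"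
    using power_add[of "real n" 4 2] power_add[of t 4 2]
    by (simp add: power_mult_distrib power_divide fact_numeral)
  moreover have "real n ^ 6 / 2187 * (1 - 36 / real n) \<le> real n ^ 6 / 2187 * t ^ 6"
    using Bernoulli_inequality[of "t - 1" 6] t0 by (intro mult_left_mono) (auto simp: t_def)
  moreover have "real n ^ 6 / (2187 / 36 * real n) \<le> real n ^ 6 / (2 * 10 ^ 23)"
    using assms n0 by (intro divide_left_mono) auto
  then have "real n ^ 6 / 2187 - real n ^ 6 / (2 * 10 ^ 23) \<le> real n ^ 6 / 2187 * (1 - 36 / real n)"
    by (simp add: right_diff_distrib)
  ultimately show thesis using that[OF le] by linarith
qed

text \<open>
  A graph with nearly the maximal number of copies is close to extremal, so that the linear bound of
  \<open>local_stability\<close> applies.  For every other graph the density is smaller than the maximum by a constant,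
  and the trivial bound \<open>n^2\<close> for the distance suffices.
\<close>

lemma perfectly_stable_F37: "perfectly_stable F37 B37"
  unfolding perfectly_stable_def
proof (intro exI[of _ "10 ^ 24"] conjI allI impI)
  fix G :: "nat pattern"
  assume G: "simple_graph G" and large: "10 ^ 24 \<le> real (card (verts G))"
  define V E where "V = verts G" and "E = edges G"
  define n where "n = real (card V)"
  define c where "c = real (card V choose 6)"
  define gap where "gap = max_density F37 (card V) - induced_density F37 G"
  define M where "M = max_density F37 (card V) * c"
  have V: "finite V" and E: "E \<subseteq> pairs V" using G by (auto simp: simple_graph_iff V_def E_def)
  have n: "10 ^ 24 \<le> n" using large by (simp add: n_def V_def)
  then have n23: "10 ^ 23 \<le> n" by simp
  have n0: "0 < n" using n by (rule less_le_trans[rotated]) simp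
  have "6 \<le> real (card V)" using n by (simp add: n_def)
  then have c0: "0 < c" by (simp add: c_def)
  have max: "real (card (copies V F)) \<le> M" if F: "F \<subseteq> pairs V" for F
  proof -
    have "simple_graph (V, F)" using V F by (simp add: simple_graph_iff)
    then show ?thesis
      using max_density_ge[of "(V, F)"] c0 F by (simp add: induced_density_F37 M_def c_def field_simps)
  qed
  have gap: "M - real (card (copies V E)) = gap * c"
    using E c0 unfolding M_def gap_def V_def E_def
    by (subst induced_density_F37) (auto simp: c_def V_def field_simps)
  have gap0: "0 \<le> gap" using max_density_ge[OF G] by (simp add: gap_def V_def)
  have "c \<le> n ^ 6"
    using of_nat_mono[OF choose_le_pow[of "card V" 6], where 'a = real] by (simp add: c_def n_def)
  then have "gap * c \<le> gap * n ^ 6" using gap0 by (rule mult_left_mono)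
  then have count_gap: "M - real (card (copies V E)) \<le> gap * n ^ 6" unfolding gap .
  have "real (clique_dist V E) \<le> 10 ^ 24 * gap * n\<^sup>2"
  proof (cases "n ^ 6 / 2187 - n ^ 6 / 10 ^ 23 \<le> real (card (copies V E))")
    case True
    then have "real (clique_dist V E) \<le> n\<^sup>2 / (4 * 10 ^ 15)"
      using global_stability[OF V _ E] n23 unfolding n_def by blast
    moreover have "n\<^sup>2 / (4 * 10 ^ 15) \<le> n\<^sup>2 / (2 * 10 ^ 15)" by (intro divide_left_mono) auto
    ultimately have near: "real (clique_dist V E) \<le> n\<^sup>2 / (2 * 10 ^ 15)" by linarith
    have "n ^ 6 / 10 ^ 23 \<le> n ^ 6 / (2 * 10 ^ 15)" by (intro divide_left_mono) auto
    then have "n ^ 6 / 2187 - n ^ 6 / (2 * 10 ^ 15) \<le> real (card (copies V E))" using True by linarith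
    then have "5 / 10 ^ 8 * n ^ 4 * real (clique_dist V E) \<le> M - real (card (copies V E))"
      using local_stability[OF V _ E max] n23 near unfolding n_def by blast
    also have "\<dots> \<le> gap * n ^ 6" by (rule count_gap)
    also have "\<dots> \<le> 5 * 10 ^ 16 * (gap * n ^ 6)"
      using gap0 n0 by simp
    also have "\<dots> = 5 / 10 ^ 8 * n ^ 4 * (10 ^ 24 * gap * n\<^sup>2)" 
      using power_add[of n 4 2] by simp
    finally show ?thesis by (rule mult_left_le_imp_le) (use n0 in simp)
  next
    (* the best clique with isolated vertices misses the bound by at most half the tolerance *)
    case False
    obtain a where a: "a \<le> card V"
      "n ^ 6 / 2187 - n ^ 6 / (2 * 10 ^ 23) \<le> real (a choose 4) * real (card V - a choose 2)"
      using clique_count_ge n23 unfolding n_def by blast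
    have "real (a choose 4) * real (card V - a choose 2) \<le> M"
      using max_density_ge_clique[OF a(1)] c0 by (simp add: M_def c_def field_simps)
    then have "n ^ 6 / (2 * 10 ^ 23) \<le> gap * n ^ 6" using a(2) False count_gap by linarith
    then have "n ^ 6 * (1 / (2 * 10 ^ 23)) \<le> n ^ 6 * gap" by (simp add: mult.commute)
    then have "1 / (2 * 10 ^ 23) \<le> gap" by (rule mult_left_le_imp_le) (use n0 in simp)
    then have "1 \<le> 10 ^ 24 * gap" by simp
    then have "1 * n\<^sup>2 \<le> 10 ^ 24 * gap * n\<^sup>2" by (rule mult_right_mono) simp
    moreover have "real (clique_dist V E) \<le> n\<^sup>2"
    proof -
      have "clique_dist V E \<le> card (sym_diff E (pairs {}))" by (rule clique_dist_le[OF V]) simp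
      also have "sym_diff E (pairs {}) = E" by (auto simp: pairs_def)
      also have "card E \<le> card (pairs V)" using V E by (intro card_mono) auto
      also have "\<dots> \<le> card V ^ 2" unfolding card_pairs[OF V] by (rule choose_le_pow)
      finally have "real (clique_dist V E) \<le> real (card V ^ 2)" by (simp only: of_nat_le_iff)
      then show ?thesis by (simp add: n_def)
    qed
    ultimately show ?thesis by linarith
  qed
  then show "real (edit_distance G B37) \<le> 10 ^ 24 *
      (max_density F37 (card (verts G)) - induced_density F37 G) * real (card (verts G)) ^ 2"
    using edit_distance_le_clique_dist[OF G] unfolding V_def E_def n_def gap_def by linarith
qed simp

lemma induced_density_blowup:
  assumes "blowup_parts B37 V"
  shows "induced_density F37 (blowup B37 V) =
    real (card (V 0) choose 4) * real (card (V 1) choose 2) / real (card (V 0) + card (V 1) choose 6)"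
proof -
  have fin: "finite (V 0)" "finite (V 1)" and disj: "V 0 \<inter> V 1 = {}"
    using assms by (auto simp: blowup_parts_def B37_def disjoint_family_on_def)
  have "V 0 \<union> V 1 - V 0 = V 1" using disj by auto
  then show ?thesis
    using fin disj pairs_mono[of "V 0" "V 0 \<union> V 1"]
    by (simp add: induced_density_F37 blowup_B37 card_copies_pairs card_Un_disjoint)
qed

text \<open>
  The description determines the limit only because some sequence of parts has the required
  proportions; rounding down provides one.
\<close>

lemma blowup_density_B37:
  assumes "0 \<le> x" "0 \<le> y" "x + y = 1"
  shows "blowup_density F37 B37 [x, y] = 15 * (x ^ 4 * y\<^sup>2)"
  unfolding blowup_density_def
proof (rule the_equality)
  have B: "verts B37 = {0, 1}" by (auto simp: B37_def)
  show lim: "\<forall>V. (\<forall>n. blowup_parts B37 (V n)) \<and>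
      (\<forall>i\<in>verts B37. (\<lambda>n. real (card (V n i)) / real n) \<longlonglongrightarrow> [x, y] ! i) \<longrightarrow>
      (\<lambda>n. induced_density F37 (blowup B37 (V n :: nat \<Rightarrow> nat set))) \<longlonglongrightarrow> 15 * (x ^ 4 * y\<^sup>2)"
    using assms(3) by (auto simp: B induced_density_blowup intro!: clique_density_tendsto)
  fix l
  assume l: "\<forall>V. (\<forall>n. blowup_parts B37 (V n)) \<and>
      (\<forall>i\<in>verts B37. (\<lambda>n. real (card (V n i)) / real n) \<longlonglongrightarrow> [x, y] ! i) \<longrightarrow>
      (\<lambda>n. induced_density F37 (blowup B37 (V n :: nat \<Rightarrow> nat set))) \<longlonglongrightarrow> l"
  define a b where "a = (\<lambda>n. nat \<lfloor>x * real n\<rfloor>)" and "b = (\<lambda>n. nat \<lfloor>y * real n\<rfloor>)"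
  define V where "V = (\<lambda>n i :: nat. if i = 0 then {0..<a n} else {a n..<a n + b n})"
  have "blowup_parts B37 (V n)" for n
    by (auto simp: blowup_parts_def B V_def disjoint_family_on_def)
  moreover have "(\<lambda>n. real (card (V n i)) / real n) \<longlonglongrightarrow> [x, y] ! i" if "i \<in> verts B37" for i
    using that nat_floor_tendsto[OF assms(1)] nat_floor_tendsto[OF assms(2)]
    by (auto simp: B V_def a_def b_def)
  ultimately have "(\<lambda>n. induced_density F37 (blowup B37 (V n))) \<longlonglongrightarrow> l"
    "(\<lambda>n. induced_density F37 (blowup B37 (V n))) \<longlonglongrightarrow> 15 * (x ^ 4 * y\<^sup>2)"
    using l lim by blast+
  then show "l = 15 * (x ^ 4 * y\<^sup>2)" by (rule LIMSEQ_unique)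
qed

lemma std_simplex_two: "u \<in> std_simplex 2 \<longleftrightarrow> (\<exists>x\<ge>0. x \<le> 1 \<and> u = [x, 1 - x])"
proof
  assume u: "u \<in> std_simplex 2"
  then obtain x y where xy: "u = [x, y]"
    by (auto simp: std_simplex_def numeral_2_eq_2 length_Suc_conv)
  have "x + y = 1" "0 \<le> x" "0 \<le> y"
    using u by (auto simp: std_simplex_def xy numeral_2_eq_2 less_Suc_eq)
  then show "\<exists>x\<ge>0. x \<le> 1 \<and> u = [x, 1 - x]" using xy by (intro exI[of _ x]) auto
qed (auto simp: std_simplex_def numeral_2_eq_2 less_Suc_eq)

lemma unique_maximiser_B37: "unique_maximiser_up_to_aut F37 B37 [2 / 3, 1 / 3]"
proof -
  have density: "blowup_density F37 B37 [x, 1 - x] = 15 * (x ^ 4 * (1 - x)\<^sup>2)"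
    if "0 \<le> x" "x \<le> 1" for x using that by (intro blowup_density_B37) auto
  have top: "blowup_density F37 B37 [2 / 3, 1 / 3] = 80 / 243"
    using density[of "2 / 3"] by (simp add: power_divide)
  have card: "card (verts B37) = 2" by (simp add: B37_def)
  have bound: "blowup_density F37 B37 u \<le> 80 / 243 - 20 / 27 * (u ! 0 - 2 / 3)\<^sup>2"
    if u: "u \<in> std_simplex 2" for u
  proof -
    obtain x where x: "0 \<le> x" "x \<le> 1" "u = [x, 1 - x]"
      using u std_simplex_two by auto
    then show ?thesis using clique_poly_le[OF x(1,2)] density[OF x(1,2)] by simp
  qed
  have mem: "[2 / 3, 1 / 3] \<in> std_simplex 2"
    unfolding std_simplex_two by (intro exI[of _ "2 / 3"]) simp
  have "maximiser F37 B37 [2 / 3, 1 / 3]"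
    unfolding maximiser_def is_arg_max_def card top
  proof (intro conjI mem notI)
    assume "\<exists>u. u \<in> std_simplex 2 \<and> 80 / 243 < blowup_density F37 B37 u"
    then obtain u where u: "u \<in> std_simplex 2" "80 / 243 < blowup_density F37 B37 u" by blast
    then show False using bound[OF u(1)] zero_le_power2[of "u ! 0 - 2 / 3"] by linarith
  qed
  moreover have "\<exists>s. automorphism s B37 \<and>
      u = map (\<lambda>i. [2 / 3, 1 / 3] ! s i) [0..<length [2 / 3, 1 / 3 :: real]]"
    if u: "maximiser F37 B37 u" for u
  proof -
    have us: "u \<in> std_simplex 2" and "\<not> blowup_density F37 B37 u < 80 / 243"
      using u mem unfolding maximiser_def is_arg_max_def card top[symmetric] by auto
    then have "(u ! 0 - 2 / 3)\<^sup>2 \<le> 0" using bound[OF us] by linarith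
    then have "u ! 0 = 2 / 3" by simp
    then have "u = [2 / 3, 1 / 3]" using us std_simplex_two by auto
    moreover have "automorphism id B37"
      unfolding automorphism_def isomorphism_def by auto
    ultimately show ?thesis by (intro exI[of _ id]) (simp add: numeral_2_eq_2)
  qed
  ultimately show ?thesis unfolding unique_maximiser_up_to_aut_def by blast
qed

theorem theorem3p17:
  shows "convergent (max_density F37) \<and> inducibility F37 = 80 / 243 \<and>
    perfectly_stable F37 B37 \<and>
    unique_maximiser_up_to_aut F37 B37 [2/3, 1/3]"
  using max_density_tendsto perfectly_stable_F37 unique_maximiser_B37
  by (auto simp: convergent_def inducibility_def limI)

end
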